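(* Let $(A,\cdot,[-,-])$ be a Jacobi algebra with unit $1_A$ and let $(A,\cdot,[-,-],\mathrm{ad}(1_A))$ be the corresponding unital relative Poisson algebra. Suppose that $(A,\cdot,[-,-],\Delta,\delta,\mathrm{ad}(1_A),-\mathrm{ad}(1_A))$ is a relative Poisson bialgebra. Then the induced relative Poisson algebra $(A\bowtie A^*,\mathrm{ad}(1_A)-(\mathrm{ad}(1_A))^* )$ is unital, that is, it is a Jacobi algebra, if and only if $\Delta(1_A)=0$. In this case, with the bilinear form $\mathcal B_d$ on $A\oplus A^*$ defined by $$\mathcal B_d(x+a^*,y+b^* )=\langle x,b^*\rangle+\langle a^*,y\rangle,\qquad x,y\in A,\ a^*,b^*\in A^*,$$ it is a Frobenius Jacobi algebra. In particular, if $(A,\cdot,[-,-],\Delta,\delta,\mathrm{ad}(1_A),-\mathrm{ad}(1_A))$ is coboundary, then $\Delta(1_A)=0$ automatically.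
   Context: All vector spaces are finite-dimensional over an algebraically closed field $\mathbb K$ of characteristic zero. Jacobi algebra. A triple $(A,\cdot,[-,-])$ with $(A,\cdot)$ a unital commutative associative algebra with unit $1_A$, $(A,[-,-])$ a Lie algebra, and $[z,x\cdot y]=[z,x]\cdot y+x\cdot[z,y]+x\cdot y\cdot[1_A,z]$ for all $x,y,z$. It is Frobenius if there is a nondegenerate symmetric bilinear form $\mathcal B$ on $A$ with $\mathcal B(x\cdot y,z)=\mathcal B(x,y\cdot z)$ and $\mathcal B([x,y],z)=\mathcal B(x,[y,z])$. Relative Poisson algebra. $(A,\cdot,[-,-],P)$, abbreviated $(A,P)$: $(A,\cdot)$ is a commutative associative (not necessarily unital) algebra, $(A,[-,-])$ is a Lie algebra, $P:A\to A$ is a linear map that is a derivation of both $\cdot$ and $[-,-]$, and $[z,x\cdot y]=[z,x]\cdot y+x\cdot[z,y]+x\cdot y\cdot P(z)$. It is unital if $(A,\cdot)$ is unital. Jacobi algebras correspond one-to-one to unital relative Poisson algebras via $P=\mathrm{ad}(1_A)$. Notation. $\mathcal L(x)y=x\cdot y$, $\mathrm{ad}(x)y=[x,y]$ (with subscripts $A$, $A^*$ indicating the algebra), $\tau(x\otimes y)=y\otimes x$. For a linear map $\varphi:A\to\mathrm{End}(V)$, $\varphi^*:A\to\mathrm{End}(V^* )$ is $\langle\varphi^*(x)u^*,v\rangle=-\langle u^*,\varphi(x)v\rangle$ (with a sign). For a linear map $T:V_1\to V_2$ between vector spaces, $T^*:V_2^*\to V_1^*$ is the usual dual map (no sign); in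 particular $(\mathrm{ad}(1_A))^*$ is the usual dual of the map $\mathrm{ad}(1_A):A\to A$. For linear maps $\phi_i$ on $V_i$, $\phi_1+\phi_2$ is the map $v_1+v_2\mapsto\phi_1(v_1)+\phi_2(v_2)$. A linear map $Q:A\to A$ dually represents $(A,P)$ if $x\cdot Q(y)-P(x)\cdot y-Q(x\cdot y)=0$, $[x,Q(y)]-[P(x),y]-Q([x,y])=0$, $[x,y\cdot z]+[y,z\cdot x]+[z,x\cdot y]+Q(x\cdot y\cdot z)=0$ for all $x,y,z\in A$. Relative Poisson coalgebra $(A,\Delta,\delta,Q)$. Linear maps $\Delta,\delta:A\to A\otimes A$, $Q:A\to A$ with $\tau\Delta=\Delta$, $(\mathrm{id}\otimes\Delta)\Delta=(\Delta\otimes\mathrm{id})\Delta$; $\tau\delta=-\delta$, $(\mathrm{id}+\xi+\xi^2)(\mathrm{id}\otimes\delta)\delta=0$ where $\xi(x\otimes y\otimes z)=y\otimes z\otimes x$; $\Delta Q=(Q\otimes\mathrm{id}+\mathrm{id}\otimes Q)\Delta$; $\delta Q=(Q\otimes\mathrm{id}+\mathrm{id}\otimes Q)\delta$; and $(\mathrm{id}\otimes\Delta)\delta(x)-(\delta\otimes\mathrm{id})\Delta(x)-(\tau\otimes\mathrm{id})(\mathrm{id}\otimes\delta)\Delta(x)-(Q\otimes\mathrm{id}\otimes\mathrm{id})(\Delta\otimes\mathrm{id})\Delta(x)=0$ for all $x\in A$. Relative Poisson bialgebra $(A,\cdot,[-,-],\Delta,\delta,P,Q)$. $(A,\cdot,[-,-],P)$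 is a relative Poisson algebra; $(A,\Delta,\delta,Q)$ is a relative Poisson coalgebra; $Q$ dually represents $(A,P)$; $\Delta P=(P\otimes\mathrm{id}-\mathrm{id}\otimes Q)\Delta$, $\delta P=(P\otimes\mathrm{id}-\mathrm{id}\otimes Q)\delta$, $(\Delta\otimes\mathrm{id})\Delta(P+Q)=0$; and for all $x,y\in A$: $\Delta(x\cdot y)=(\mathcal L(x)\otimes\mathrm{id})\Delta(y)+(\mathrm{id}\otimes\mathcal L(y))\Delta(x)$; $\delta([x,y])=(\mathrm{ad}(x)\otimes\mathrm{id}+\mathrm{id}\otimes\mathrm{ad}(x))\delta(y)-(\mathrm{ad}(y)\otimes\mathrm{id}+\mathrm{id}\otimes\mathrm{ad}(y))\delta(x)$; $\delta(x\cdot y)-(\mathrm{id}\otimes\mathrm{ad}(y))\Delta(x)-(\mathcal L(x)\otimes\mathrm{id})\delta(y)-(\mathrm{id}\otimes\mathrm{ad}(x))\Delta(y)-(\mathcal L(y)\otimes\mathrm{id})\delta(x)-(\mathrm{id}\otimes Q)\Delta(x\cdot y)=0$; $\Delta([x,y])-(\mathcal L(y)\otimes\mathrm{id})\delta(x)-(\mathrm{id}\otimes\mathrm{ad}(x))\Delta(y)+(\mathrm{id}\otimes\mathcal L(y))\delta(x)-(\mathrm{ad}(x)\otimes\mathrm{id})\Delta(y)+\Delta(P(x)\cdot y)=0$. It is coboundary if there is $r\in A\otimes A$ with $\Delta(x)=(\mathrm{id}\otimes\mathcal L(x)-\mathcal L(x)\otimes\mathrm{id})r$ and $\delta(x)=(\mathrm{ad}(x)\otimes\mathrm{id}+\mathrm{id}\otimes\mathrm{ad}(x))r$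 for all $x\in A$. Induced relative Poisson algebra. For a relative Poisson bialgebra, $A^*$ is a relative Poisson algebra with $a^*\cdot_{A^*}b^*=\Delta^*(a^*\otimes b^* )$, $[a^*,b^*]_{A^*}=\delta^*(a^*\otimes b^* )$ and derivation $Q^*$. The induced relative Poisson algebra $(A\bowtie A^*,P+Q^* )$ is $A\oplus A^*$ with $(x+a^* )\cdot(y+b^* )=x\cdot_Ay-\mathcal L_{A^*}^*(a^* )y-\mathcal L_{A^*}^*(b^* )x+a^*\cdot_{A^*}b^*-\mathcal L_A^*(x)b^*-\mathcal L_A^*(y)a^*$, $[x+a^*,y+b^*]=[x,y]_A+\mathrm{ad}_{A^*}^*(a^* )y-\mathrm{ad}_{A^*}^*(b^* )x+[a^*,b^*]_{A^*}+\mathrm{ad}_A^*(x)b^*-\mathrm{ad}_A^*(y)a^*$, and derivation $P+Q^*$ (which is a relative Poisson algebra). *)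

theory Defs
  imports
    "HOL-Computational_Algebra.Polynomial"
    "HOL-Library.Function_Algebras"
    "HOL-Library.Product_Plus"
begin

section \<open>Linear and bilinear maps between subspaces of ambient spaces\<close>

text \<open>
  The dual space of a space of type \<open>'a\<close> is a set of functions \<open>'a \<Rightarrow> 'k\<close>, not a type. Algebraic
  structures therefore live on a finite-dimensional subspace \<open>V\<close> of an ambient vector space, so
  that the same locales apply to \<open>A\<close> (with \<open>V = UNIV\<close>) and to \<open>A \<oplus> A\<^sup>*\<close>.
\<close>

locale fd_space = vector_space scale
  for scale :: "'k::field \<Rightarrow> 'v::ab_group_add \<Rightarrow> 'v" +
  fixes V :: "'v set"
  assumes finite_dim: "\<exists>B. finite B \<and> span B = V"

definition linear_on ::
    "('k \<Rightarrow> 'v::plus \<Rightarrow> 'v) \<Rightarrow> 'v set \<Rightarrow> ('k \<Rightarrow> 'w::plus \<Rightarrow> 'w) \<Rightarrow> 'w set \<Rightarrow> ('v \<Rightarrow> 'w) \<Rightarrow> bool"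
  where "linear_on s V s' W f \<longleftrightarrow>
    (\<forall>x\<in>V. f x \<in> W) \<and>
    (\<forall>x\<in>V. \<forall>y\<in>V. f (x + y) = f x + f y) \<and>
    (\<forall>c. \<forall>x\<in>V. f (s c x) = s' c (f x))"

definition bilinear_on ::
    "('k \<Rightarrow> 'v::plus \<Rightarrow> 'v) \<Rightarrow> 'v set \<Rightarrow> ('k \<Rightarrow> 'w::plus \<Rightarrow> 'w) \<Rightarrow> 'w set \<Rightarrow> ('v \<Rightarrow> 'v \<Rightarrow> 'w) \<Rightarrow> bool"
  where "bilinear_on s V s' W b \<longleftrightarrow>
    (\<forall>x\<in>V. linear_on s V s' W (b x)) \<and> (\<forall>y\<in>V. linear_on s V s' W (\<lambda>x. b x y))"

section \<open>Algebras\<close>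

locale comm_assoc_algebra = fd_space scale V
  for scale :: "'k::field \<Rightarrow> 'v::ab_group_add \<Rightarrow> 'v" and V +
  fixes mul :: "'v \<Rightarrow> 'v \<Rightarrow> 'v"
  assumes mult_bilinear: "bilinear_on scale V scale V mul"
    and mult_commute: "\<lbrakk>x \<in> V; y \<in> V\<rbrakk> \<Longrightarrow> mul x y = mul y x"
    and mult_assoc: "\<lbrakk>x \<in> V; y \<in> V; z \<in> V\<rbrakk> \<Longrightarrow> mul (mul x y) z = mul x (mul y z)"

locale lie_algebra = fd_space scale V
  for scale :: "'k::field \<Rightarrow> 'v::ab_group_add \<Rightarrow> 'v" and V +
  fixes br :: "'v \<Rightarrow> 'v \<Rightarrow> 'v"
  assumes br_bilinear: "bilinear_on scale V scale V br"
    and br_self: "x \<in> V \<Longrightarrow> br x x = 0"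
    and br_jacobi: "\<lbrakk>x \<in> V; y \<in> V; z \<in> V\<rbrakk> \<Longrightarrow>
      br x (br y z) + br y (br z x) + br z (br x y) = 0"

locale jacobi_algebra = comm_assoc_algebra scale V mul + lie_algebra scale V br
  for scale :: "'k::field \<Rightarrow> 'v::ab_group_add \<Rightarrow> 'v" and V mul br +
  fixes e :: 'v
  assumes unit_closed: "e \<in> V"
    and unit: "x \<in> V \<Longrightarrow> mul e x = x"
    and jacobi_compat: "\<lbrakk>x \<in> V; y \<in> V; z \<in> V\<rbrakk> \<Longrightarrow>
      br z (mul x y) = mul (br z x) y + mul x (br z y) + mul (mul x y) (br e z)"

locale frobenius_jacobi_algebra = jacobi_algebra scale V mul br e
  for scale :: "'k::field \<Rightarrow> 'v::ab_group_add \<Rightarrow> 'v" and V mul br e +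
  fixes form :: "'v \<Rightarrow> 'v \<Rightarrow> 'k"
  assumes form_bilinear: "bilinear_on scale V (*) UNIV form"
    and form_sym: "\<lbrakk>x \<in> V; y \<in> V\<rbrakk> \<Longrightarrow> form x y = form y x"
    and form_nondegenerate: "\<lbrakk>x \<in> V; \<And>y. y \<in> V \<Longrightarrow> form x y = 0\<rbrakk> \<Longrightarrow> x = 0"
    and form_mult: "\<lbrakk>x \<in> V; y \<in> V; z \<in> V\<rbrakk> \<Longrightarrow> form (mul x y) z = form x (mul y z)"
    and form_br: "\<lbrakk>x \<in> V; y \<in> V; z \<in> V\<rbrakk> \<Longrightarrow> form (br x y) z = form x (br y z)"

locale relative_poisson_algebra = comm_assoc_algebra scale V mul + lie_algebra scale V br
  for scale :: "'k::field \<Rightarrow> 'v::ab_group_add \<Rightarrow> 'v" and V mul br +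
  fixes P :: "'v \<Rightarrow> 'v"
  assumes P_linear: "linear_on scale V scale V P"
    and P_mult: "\<lbrakk>x \<in> V; y \<in> V\<rbrakk> \<Longrightarrow> P (mul x y) = mul (P x) y + mul x (P y)"
    and P_br: "\<lbrakk>x \<in> V; y \<in> V\<rbrakk> \<Longrightarrow> P (br x y) = br (P x) y + br x (P y)"
    and relative_leibniz: "\<lbrakk>x \<in> V; y \<in> V; z \<in> V\<rbrakk> \<Longrightarrow>
      br z (mul x y) = mul (br z x) y + mul x (br z y) + mul (mul x y) (P z)"

locale unital_relative_poisson_algebra = relative_poisson_algebra +
  assumes unital: "\<exists>e\<in>V. \<forall>x\<in>V. mul e x = x"

definition dually_represents ::
    "('a \<Rightarrow> 'a \<Rightarrow> 'a::ab_group_add) \<Rightarrow> ('a \<Rightarrow> 'a \<Rightarrow> 'a) \<Rightarrow> ('a \<Rightarrow> 'a) \<Rightarrow> ('a \<Rightarrow> 'a) \<Rightarrow> bool"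
  where "dually_represents mul br P Q \<longleftrightarrow>
    (\<forall>x y. mul x (Q y) - mul (P x) y - Q (mul x y) = 0) \<and>
    (\<forall>x y. br x (Q y) - br (P x) y - Q (br x y) = 0) \<and>
    (\<forall>x y z. br x (mul y z) + br y (mul z x) + br z (mul x y) + Q (mul (mul x y) z) = 0)"

section \<open>Dual space and tensor powers\<close>

definition dual_space :: "('k::field \<Rightarrow> 'a::ab_group_add \<Rightarrow> 'a) \<Rightarrow> ('a \<Rightarrow> 'k) set"
  where "dual_space s = {f. Vector_Spaces.linear s (*) f}"

text \<open>
  For finite-dimensional \<open>A\<close>, the tensor powers \<open>A \<otimes> A\<close> and \<open>A \<otimes> A \<otimes> A\<close> are realised as the spaces
  of bilinear and trilinear forms on \<open>A\<^sup>*\<close>, where \<open>x \<otimes> y\<close> is the form \<open>(f, g) \<mapsto> f x * g y\<close>.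
  Forms are set to \<open>0\<close> outside \<open>A\<^sup>*\<close>, so that equality of tensors is equality of functions and
  tensors are added pointwise. In particular \<open>t f g\<close> is the pairing \<open>\<langle>t, f \<otimes> g\<rangle>\<close>.
  The lemmas below give the universal property of \<open>A \<otimes> A\<close> and the values of all operations on pure
  tensors.
\<close>

definition ext2 :: "('k::field \<Rightarrow> 'a::ab_group_add \<Rightarrow> 'a) \<Rightarrow>
    (('a \<Rightarrow> 'k) \<Rightarrow> ('a \<Rightarrow> 'k) \<Rightarrow> 'k) \<Rightarrow> ('a \<Rightarrow> 'k) \<Rightarrow> ('a \<Rightarrow> 'k) \<Rightarrow> 'k"
  where "ext2 s F = (\<lambda>f g. if f \<in> dual_space s \<and> g \<in> dual_space s then F f g else 0)"

definition ext3 :: "('k::field \<Rightarrow> 'a::ab_group_add \<Rightarrow> 'a) \<Rightarrow>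
    (('a \<Rightarrow> 'k) \<Rightarrow> ('a \<Rightarrow> 'k) \<Rightarrow> ('a \<Rightarrow> 'k) \<Rightarrow> 'k) \<Rightarrow>
    ('a \<Rightarrow> 'k) \<Rightarrow> ('a \<Rightarrow> 'k) \<Rightarrow> ('a \<Rightarrow> 'k) \<Rightarrow> 'k"
  where "ext3 s F = (\<lambda>f g h.
    if f \<in> dual_space s \<and> g \<in> dual_space s \<and> h \<in> dual_space s then F f g h else 0)"

definition fun_scale :: "'k::times \<Rightarrow> ('a \<Rightarrow> 'k) \<Rightarrow> 'a \<Rightarrow> 'k"
  where "fun_scale c f = (\<lambda>v. c * f v)"

definition tensor2_scale :: "'k::times \<Rightarrow> ('a \<Rightarrow> 'b \<Rightarrow> 'k) \<Rightarrow> 'a \<Rightarrow> 'b \<Rightarrow> 'k"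
  where "tensor2_scale c t = (\<lambda>f g. c * t f g)"

definition tensor2 :: "('k::field \<Rightarrow> 'a::ab_group_add \<Rightarrow> 'a) \<Rightarrow>
    (('a \<Rightarrow> 'k) \<Rightarrow> ('a \<Rightarrow> 'k) \<Rightarrow> 'k) set"
  where "tensor2 s = {t. bilinear_on fun_scale (dual_space s) (*) UNIV t \<and> ext2 s t = t}"

definition pure2 :: "('k::field \<Rightarrow> 'a::ab_group_add \<Rightarrow> 'a) \<Rightarrow> 'a \<Rightarrow> 'a \<Rightarrow>
    ('a \<Rightarrow> 'k) \<Rightarrow> ('a \<Rightarrow> 'k) \<Rightarrow> 'k"
  where "pure2 s x y = ext2 s (\<lambda>f g. f x * g y)"

definition pure3 :: "('k::field \<Rightarrow> 'a::ab_group_add \<Rightarrow> 'a) \<Rightarrow> 'a \<Rightarrow> 'a \<Rightarrow> 'a \<Rightarrow>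
    ('a \<Rightarrow> 'k) \<Rightarrow> ('a \<Rightarrow> 'k) \<Rightarrow> ('a \<Rightarrow> 'k) \<Rightarrow> 'k"
  where "pure3 s x y z = ext3 s (\<lambda>f g h. f x * g y * h z)"

text \<open>The maps \<open>S \<otimes> T\<close> and \<open>S \<otimes> T \<otimes> U\<close> for linear endomorphisms of \<open>A\<close>.\<close>

definition tmap2 :: "('k::field \<Rightarrow> 'a::ab_group_add \<Rightarrow> 'a) \<Rightarrow> ('a \<Rightarrow> 'a) \<Rightarrow> ('a \<Rightarrow> 'a) \<Rightarrow>
    (('a \<Rightarrow> 'k) \<Rightarrow> ('a \<Rightarrow> 'k) \<Rightarrow> 'k) \<Rightarrow> ('a \<Rightarrow> 'k) \<Rightarrow> ('a \<Rightarrow> 'k) \<Rightarrow> 'k"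
  where "tmap2 s S T t = ext2 s (\<lambda>f g. t (f \<circ> S) (g \<circ> T))"

definition tmap3 :: "('k::field \<Rightarrow> 'a::ab_group_add \<Rightarrow> 'a) \<Rightarrow>
    ('a \<Rightarrow> 'a) \<Rightarrow> ('a \<Rightarrow> 'a) \<Rightarrow> ('a \<Rightarrow> 'a) \<Rightarrow>
    (('a \<Rightarrow> 'k) \<Rightarrow> ('a \<Rightarrow> 'k) \<Rightarrow> ('a \<Rightarrow> 'k) \<Rightarrow> 'k) \<Rightarrow>
    ('a \<Rightarrow> 'k) \<Rightarrow> ('a \<Rightarrow> 'k) \<Rightarrow> ('a \<Rightarrow> 'k) \<Rightarrow> 'k"
  where "tmap3 s S T U t = ext3 s (\<lambda>f g h. t (f \<circ> S) (g \<circ> T) (h \<circ> U))"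

text \<open>The maps \<open>id \<otimes> D\<close> and \<open>D \<otimes> id\<close> for linear \<open>D : A \<rightarrow> A \<otimes> A\<close>.\<close>

definition id_tensor :: "('k::field \<Rightarrow> 'a::ab_group_add \<Rightarrow> 'a) \<Rightarrow>
    ('a \<Rightarrow> ('a \<Rightarrow> 'k) \<Rightarrow> ('a \<Rightarrow> 'k) \<Rightarrow> 'k) \<Rightarrow> (('a \<Rightarrow> 'k) \<Rightarrow> ('a \<Rightarrow> 'k) \<Rightarrow> 'k) \<Rightarrow>
    ('a \<Rightarrow> 'k) \<Rightarrow> ('a \<Rightarrow> 'k) \<Rightarrow> ('a \<Rightarrow> 'k) \<Rightarrow> 'k"
  where "id_tensor s D t = ext3 s (\<lambda>f g h. t f (\<lambda>x. D x g h))"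

definition tensor_id :: "('k::field \<Rightarrow> 'a::ab_group_add \<Rightarrow> 'a) \<Rightarrow>
    ('a \<Rightarrow> ('a \<Rightarrow> 'k) \<Rightarrow> ('a \<Rightarrow> 'k) \<Rightarrow> 'k) \<Rightarrow> (('a \<Rightarrow> 'k) \<Rightarrow> ('a \<Rightarrow> 'k) \<Rightarrow> 'k) \<Rightarrow>
    ('a \<Rightarrow> 'k) \<Rightarrow> ('a \<Rightarrow> 'k) \<Rightarrow> ('a \<Rightarrow> 'k) \<Rightarrow> 'k"
  where "tensor_id s D t = ext3 s (\<lambda>f g h. t (\<lambda>x. D x f g) h)"

text \<open>\<open>\<tau>\<close>, \<open>\<tau> \<otimes> id\<close> and \<open>\<xi>(x \<otimes> y \<otimes> z) = y \<otimes> z \<otimes> x\<close>.\<close>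

definition flip2 :: "('b \<Rightarrow> 'b \<Rightarrow> 'k) \<Rightarrow> 'b \<Rightarrow> 'b \<Rightarrow> 'k"
  where "flip2 t = (\<lambda>f g. t g f)"

definition flip12 :: "('b \<Rightarrow> 'b \<Rightarrow> 'b \<Rightarrow> 'k) \<Rightarrow> 'b \<Rightarrow> 'b \<Rightarrow> 'b \<Rightarrow> 'k"
  where "flip12 t = (\<lambda>f g h. t g f h)"

definition cycle3 :: "('b \<Rightarrow> 'b \<Rightarrow> 'b \<Rightarrow> 'k) \<Rightarrow> 'b \<Rightarrow> 'b \<Rightarrow> 'b \<Rightarrow> 'k"
  where "cycle3 t = (\<lambda>f g h. t h f g)"

lemma sum_fun_apply: "(\<Sum>i\<in>I. F i) x = (\<Sum>i\<in>I. F i x)"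
  for F :: "'i \<Rightarrow> 'b \<Rightarrow> 'c::comm_monoid_add"
  by (induction I rule: infinite_finite_induct)
    (simp_all only: sum.infinite sum.empty sum.insert not_False_eq_True plus_fun_apply zero_fun_apply)

lemma tensor2_eq_0: "\<lbrakk>t \<in> tensor2 s; f \<notin> dual_space s \<or> g \<notin> dual_space s\<rbrakk> \<Longrightarrow> t f g = 0"
  by (metis (mono_tags, lifting) ext2_def mem_Collect_eq tensor2_def)

lemma tensor2I:
  "\<lbrakk>bilinear_on fun_scale (dual_space s) (*) UNIV t;
    \<And>f g. f \<notin> dual_space s \<or> g \<notin> dual_space s \<Longrightarrow> t f g = 0\<rbrakk> \<Longrightarrow> t \<in> tensor2 s"
  by (auto simp: tensor2_def ext2_def fun_eq_iff)

lemma zero_in_tensor2: "0 \<in> tensor2 s"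
  by (rule tensor2I) (auto simp: bilinear_on_def linear_on_def)

lemma add_in_tensor2:
  assumes "t \<in> tensor2 s" "u \<in> tensor2 s"
  shows "t + u \<in> tensor2 s"
proof (rule tensor2I)
  show "bilinear_on fun_scale (dual_space s) (*) UNIV (t + u)"
    using assms by (simp add: tensor2_def bilinear_on_def linear_on_def algebra_simps)
qed (use tensor2_eq_0[OF assms(1)] tensor2_eq_0[OF assms(2)] in auto)

lemma scale_in_tensor2:
  assumes "t \<in> tensor2 s"
  shows "tensor2_scale c t \<in> tensor2 s"
proof (rule tensor2I)
  show "bilinear_on fun_scale (dual_space s) (*) UNIV (tensor2_scale c t)"
    using assms by (simp add: tensor2_def bilinear_on_def linear_on_def tensor2_scale_def algebra_simps)
qed (use tensor2_eq_0[OF assms] in \<open>auto simp: tensor2_scale_def\<close>)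

lemma sum_in_tensor2: "(\<And>i. i \<in> I \<Longrightarrow> F i \<in> tensor2 s) \<Longrightarrow> (\<Sum>i\<in>I. F i) \<in> tensor2 s"
  by (induction I rule: infinite_finite_induct) (auto intro: zero_in_tensor2 add_in_tensor2)

lemma linear_on_tensor2_sum:
  fixes h :: "_ \<Rightarrow> 'w::ab_group_add"
  assumes h: "linear_on tensor2_scale (tensor2 s) s' W h"
    and "\<And>i. i \<in> I \<Longrightarrow> F i \<in> tensor2 s"
  shows "h (\<Sum>i\<in>I. F i) = (\<Sum>i\<in>I. h (F i))"
proof -
  have "h (0 + 0) = h 0 + h 0"
    using h zero_in_tensor2[of s] unfolding linear_on_def by blast
  then have h0: "h 0 = 0" by simp
  show ?thesis
    using assms(2)
  proof (induction I rule: infinite_finite_induct)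
    case (insert i I)
    then have "h (F i + sum F I) = h (F i) + h (sum F I)"
      using h sum_in_tensor2[of I F s] unfolding linear_on_def by blast
    then show ?case
      using insert by (simp only: sum.insert not_False_eq_True insertI2)
  qed (simp_all add: h0)
qed

lemma (in vector_space) dual_space_add:
  "\<lbrakk>f \<in> dual_space scale; g \<in> dual_space scale\<rbrakk> \<Longrightarrow> f + g \<in> dual_space scale"
  unfolding dual_space_def mem_Collect_eq
  by unfold_locales (simp_all add: Vector_Spaces.linear_iff algebra_simps)

lemma (in vector_space) dual_space_fun_scale:
  "f \<in> dual_space scale \<Longrightarrow> fun_scale c f \<in> dual_space scale"
  unfolding dual_space_def mem_Collect_eq
  by unfold_locales (simp_all add: fun_scale_def Vector_Spaces.linear_iff algebra_simps)

lemma (in vector_space) pure2_in_tensor2: "pure2 scale x y \<in> tensor2 scale"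
proof (rule tensor2I)
  have "fun_scale c f x = c * f x" for c f and x :: 'b
    by (simp add: fun_scale_def)
  then show "bilinear_on fun_scale (dual_space scale) (*) UNIV (pure2 scale x y)"
    by (auto simp: bilinear_on_def linear_on_def pure2_def ext2_def
        dual_space_add dual_space_fun_scale algebra_simps)
qed (auto simp: pure2_def ext2_def)

context finite_dimensional_vector_space
begin

lemma coordinate_in_dual_space: "(\<lambda>v. representation Basis v i) \<in> dual_space scale"
  unfolding dual_space_def mem_Collect_eq
  by unfold_locales
    (simp_all add: representation_add representation_scale independent_Basis span_Basis algebra_simps)

lemma dual_space_expand:
  assumes "f \<in> dual_space scale"
  shows "f = (\<Sum>i\<in>Basis. fun_scale (f i) (\<lambda>v. representation Basis v i))"
proof
  fix v
  interpret f: Vector_Spaces.linear scale "(*)" f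
    using assms by (simp add: dual_space_def)
  have "f v = f (\<Sum>i\<in>Basis. scale (representation Basis v i) i)"
    by (subst sum_representation_eq) (auto simp: independent_Basis span_Basis finite_Basis)
  also have "\<dots> = (\<Sum>i\<in>Basis. representation Basis v i * f i)"
    by (simp add: f.sum f.scale)
  finally show "f v = (\<Sum>i\<in>Basis. fun_scale (f i) (\<lambda>v. representation Basis v i)) v"
    by (simp add: sum_fun_apply fun_scale_def mult.commute)
qed

lemma tensor2_expand:
  assumes t: "t \<in> tensor2 scale"
  shows "t = (\<Sum>i\<in>Basis. \<Sum>j\<in>Basis.
    tensor2_scale (t (\<lambda>v. representation Basis v i) (\<lambda>v. representation Basis v j)) (pure2 scale i j))"
    (is "t = ?r")
proof (intro ext)
  fix f g
  let ?c = "\<lambda>i v. representation Basis v i"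
  have add: "t (f + f') g = t f g + t f' g" "t g (f + f') = t g f + t g f'"
    and sc: "t (fun_scale c f) g = c * t f g" "t g (fun_scale c f) = c * t g f"
    if "f \<in> dual_space scale" "f' \<in> dual_space scale" "g \<in> dual_space scale" for f f' g c
    using t that unfolding tensor2_def bilinear_on_def linear_on_def by auto
  have z: "0 \<in> dual_space scale"
    unfolding dual_space_def mem_Collect_eq by unfold_locales (simp_all add: algebra_simps)
  have z0: "t 0 g = 0" "t g 0 = 0" if "g \<in> dual_space scale" for g
    using sc[OF z z that, of 0] by (simp_all add: fun_scale_def zero_fun_def)
  have cl: "(\<Sum>i\<in>I. fun_scale (a i) (?c i)) \<in> dual_space scale" for I a
    by (induction I rule: infinite_finite_induct)
      (simp_all only: sum.infinite sum.empty sum.insert not_False_eq_True z dual_space_add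
        dual_space_fun_scale coordinate_in_dual_space)
  have s1: "t (\<Sum>i\<in>I. fun_scale (a i) (?c i)) g = (\<Sum>i\<in>I. a i * t (?c i) g)"
   and s2: "t g (\<Sum>i\<in>I. fun_scale (a i) (?c i)) = (\<Sum>i\<in>I. a i * t g (?c i))"
    if "g \<in> dual_space scale" for g I a
    using that by (induction I rule: infinite_finite_induct)
      (simp_all only: sum.infinite sum.empty sum.insert not_False_eq_True z0 add sc cl
        coordinate_in_dual_space dual_space_fun_scale)
  show "t f g = ?r f g"
  proof (cases "f \<in> dual_space scale \<and> g \<in> dual_space scale")
    case True
    then have f: "f \<in> dual_space scale" and g: "g \<in> dual_space scale" by auto
    have "t f g = t (\<Sum>i\<in>Basis. fun_scale (f i) (?c i)) g"
      by (rule arg_cong[OF dual_space_expand[OF f], of "\<lambda>f. t f g"])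
    also have "\<dots> = (\<Sum>i\<in>Basis. f i * t (?c i) g)"
      by (rule s1[OF g])
    also have "\<dots> = (\<Sum>i\<in>Basis. f i * t (?c i) (\<Sum>j\<in>Basis. fun_scale (g j) (?c j)))"
      by (simp only: dual_space_expand[OF g, symmetric])
    also have "\<dots> = (\<Sum>i\<in>Basis. f i * (\<Sum>j\<in>Basis. g j * t (?c i) (?c j)))"
      by (simp only: s2 coordinate_in_dual_space)
    also have "\<dots> = ?r f g"
      using f g by (simp add: sum_fun_apply tensor2_scale_def pure2_def ext2_def sum_distrib_left mult_ac)
    finally show ?thesis .
  next
    case False
    then have "f \<notin> dual_space scale \<or> g \<notin> dual_space scale" by simp
    then have "t f g = 0" by (rule tensor2_eq_0[OF t])
    with False show ?thesis
      by (auto simp: sum_fun_apply tensor2_scale_def pure2_def ext2_def)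
  qed
qed

lemma tensor2_universal_unique:
  fixes h h' :: "_ \<Rightarrow> 'w::ab_group_add"
  assumes "linear_on tensor2_scale (tensor2 scale) s' W h"
    and "linear_on tensor2_scale (tensor2 scale) s' W h'"
    and "\<And>x y. h (pure2 scale x y) = h' (pure2 scale x y)" and "t \<in> tensor2 scale"
  shows "h t = h' t"
proof -
  have sc: "k (tensor2_scale c (pure2 scale i j)) = s' c (k (pure2 scale i j))"
    if "linear_on tensor2_scale (tensor2 scale) s' W k" for k c i j
    using that pure2_in_tensor2 unfolding linear_on_def by blast
  show ?thesis
    by (subst (1 2) tensor2_expand[OF assms(4)])
      (simp add: linear_on_tensor2_sum[OF assms(1)] linear_on_tensor2_sum[OF assms(2)]
        sum_in_tensor2 scale_in_tensor2 pure2_in_tensor2 sc[OF assms(1)] sc[OF assms(2)] assms(3))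
qed

lemma tensor2_universal_exists:
  fixes \<beta> :: "'b \<Rightarrow> 'b \<Rightarrow> 'w::ab_group_add"
  assumes "vector_space s'" and \<beta>: "bilinear_on scale UNIV s' UNIV \<beta>"
  shows "\<exists>h. linear_on tensor2_scale (tensor2 scale) s' UNIV h \<and> (\<forall>x y. h (pure2 scale x y) = \<beta> x y)"
proof -
  interpret w: vector_space s' by fact
  let ?c = "\<lambda>i v. representation Basis v i"
  define h where "h t = (\<Sum>i\<in>Basis. \<Sum>j\<in>Basis. s' (t (?c i) (?c j)) (\<beta> i j))" for t
  have lin: "Vector_Spaces.linear scale s' (\<beta> x)" "Vector_Spaces.linear scale s' (\<lambda>x. \<beta> x y)" for x y
    using \<beta> by (auto simp: Vector_Spaces.linear_iff bilinear_on_def linear_on_def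
        vector_space_axioms w.vector_space_axioms)
  have ex: "(\<Sum>i\<in>Basis. scale (?c i x) i) = x" for x
    by (rule sum_representation_eq) (auto simp: independent_Basis span_Basis finite_Basis)
  have "h (pure2 scale x y) = \<beta> x y" for x y
  proof -
    interpret r: Vector_Spaces.linear scale s' "\<beta> u" for u by (rule lin)
    interpret l: Vector_Spaces.linear scale s' "\<lambda>x. \<beta> x y" by (rule lin)
    have "\<beta> x y = \<beta> (\<Sum>i\<in>Basis. scale (?c i x) i) y" by (simp add: ex)
    also have "\<dots> = (\<Sum>i\<in>Basis. s' (?c i x) (\<beta> i y))" by (simp add: l.sum l.scale)
    also have "\<dots> = (\<Sum>i\<in>Basis. s' (?c i x) (\<beta> i (\<Sum>j\<in>Basis. scale (?c j y) j)))" by (simp add: ex)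
    also have "\<dots> = (\<Sum>i\<in>Basis. s' (?c i x) (\<Sum>j\<in>Basis. s' (?c j y) (\<beta> i j)))"
      by (simp only: r.sum r.scale)
    also have "\<dots> = h (pure2 scale x y)"
      by (simp add: h_def pure2_def ext2_def coordinate_in_dual_space w.scale_sum_right)
    finally show ?thesis by simp
  qed
  moreover have "linear_on tensor2_scale (tensor2 scale) s' UNIV h"
    by (simp add: linear_on_def h_def tensor2_scale_def w.scale_left_distrib sum.distrib w.scale_sum_right)
  ultimately show ?thesis by blast
qed

end

lemma dual_space_comp:
  assumes "f \<in> dual_space s" "Vector_Spaces.linear s s S"
  shows "f \<circ> S \<in> dual_space s"
  using assms Vector_Spaces.linear_compose[of s s S "(*)" f] by (simp add: dual_space_def)

lemma tmap2_pure2: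
  assumes "Vector_Spaces.linear s s S" "Vector_Spaces.linear s s T"
  shows "tmap2 s S T (pure2 s x y) = pure2 s (S x) (T y)"
  using assms by (auto simp: tmap2_def pure2_def ext2_def dual_space_comp fun_eq_iff)

lemma tmap3_pure3:
  assumes "Vector_Spaces.linear s s S" "Vector_Spaces.linear s s T" "Vector_Spaces.linear s s U"
  shows "tmap3 s S T U (pure3 s x y z) = pure3 s (S x) (T y) (U z)"
  using assms by (auto simp: tmap3_def pure3_def ext3_def dual_space_comp fun_eq_iff)

lemma flip2_pure2: "flip2 (pure2 s x y) = pure2 s y x"
  by (auto simp: flip2_def pure2_def ext2_def fun_eq_iff)

lemma flip12_pure3: "flip12 (pure3 s x y z) = pure3 s y x z"
  by (auto simp: flip12_def pure3_def ext3_def fun_eq_iff)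

lemma cycle3_pure3: "cycle3 (pure3 s x y z) = pure3 s y z x"
  by (auto simp: cycle3_def pure3_def ext3_def fun_eq_iff)

lemma (in vector_space) functional_of_comultiplication:
  assumes D: "linear_on scale UNIV tensor2_scale (tensor2 scale) D"
  shows "(\<lambda>x. D x f g) \<in> dual_space scale"
  unfolding dual_space_def mem_Collect_eq
  by unfold_locales
     (use D in \<open>simp_all add: linear_on_def tensor2_scale_def algebra_simps\<close>)

lemma (in vector_space) id_tensor_pure2:
  assumes "linear_on scale UNIV tensor2_scale (tensor2 scale) D"
    and "D y = (\<Sum>i\<in>I. pure2 scale (u i) (v i))"
  shows "id_tensor scale D (pure2 scale x y) = (\<Sum>i\<in>I. pure3 scale x (u i) (v i))"
proof -
  show ?thesis
    using functional_of_comultiplication[OF assms(1)]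
    by (auto simp: fun_eq_iff id_tensor_def pure2_def pure3_def ext2_def ext3_def sum_fun_apply assms(2)
        sum_distrib_left mult.assoc intro!: sum.cong)
qed

lemma (in vector_space) tensor_id_pure2:
  assumes "linear_on scale UNIV tensor2_scale (tensor2 scale) D"
    and "D x = (\<Sum>i\<in>I. pure2 scale (u i) (v i))"
  shows "tensor_id scale D (pure2 scale x y) = (\<Sum>i\<in>I. pure3 scale (u i) (v i) y)"
proof -
  show ?thesis
    using functional_of_comultiplication[OF assms(1)]
    by (auto simp: fun_eq_iff tensor_id_def pure2_def pure3_def ext2_def ext3_def sum_fun_apply assms(2)
        sum_distrib_right mult.assoc intro!: sum.cong)
qed

section \<open>Coalgebras and bialgebras\<close>

locale relative_poisson_coalgebra = fd_space scale UNIV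
  for scale :: "'k::field \<Rightarrow> 'a::ab_group_add \<Rightarrow> 'a" +
  fixes \<Delta> \<delta> :: "'a \<Rightarrow> ('a \<Rightarrow> 'k) \<Rightarrow> ('a \<Rightarrow> 'k) \<Rightarrow> 'k" and Q :: "'a \<Rightarrow> 'a"
  assumes \<Delta>_linear: "linear_on scale UNIV tensor2_scale (tensor2 scale) \<Delta>"
    and \<delta>_linear: "linear_on scale UNIV tensor2_scale (tensor2 scale) \<delta>"
    and Q_linear: "Vector_Spaces.linear scale scale Q"
    and \<Delta>_cocommutative: "flip2 (\<Delta> x) = \<Delta> x"
    and \<Delta>_coassociative: "id_tensor scale \<Delta> (\<Delta> x) = tensor_id scale \<Delta> (\<Delta> x)"
    and \<delta>_skew: "flip2 (\<delta> x) = - \<delta> x"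
    and \<delta>_cojacobi: "id_tensor scale \<delta> (\<delta> x) + cycle3 (id_tensor scale \<delta> (\<delta> x)) +
      cycle3 (cycle3 (id_tensor scale \<delta> (\<delta> x))) = 0"
    and \<Delta>_Q: "\<Delta> (Q x) = tmap2 scale Q id (\<Delta> x) + tmap2 scale id Q (\<Delta> x)"
    and \<delta>_Q: "\<delta> (Q x) = tmap2 scale Q id (\<delta> x) + tmap2 scale id Q (\<delta> x)"
    and relative_coleibniz: "id_tensor scale \<Delta> (\<delta> x) - tensor_id scale \<delta> (\<Delta> x) -
      flip12 (id_tensor scale \<delta> (\<Delta> x)) - tmap3 scale Q id id (tensor_id scale \<Delta> (\<Delta> x)) = 0"

locale relative_poisson_bialgebra =
  relative_poisson_algebra scale UNIV mul br P + relative_poisson_coalgebra scale \<Delta> \<delta> Q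
  for scale :: "'k::field \<Rightarrow> 'a::ab_group_add \<Rightarrow> 'a" and mul br \<Delta> \<delta> P Q +
  assumes Q_dually_represents: "dually_represents mul br P Q"
    and \<Delta>_P: "\<Delta> (P x) = tmap2 scale P id (\<Delta> x) - tmap2 scale id Q (\<Delta> x)"
    and \<delta>_P: "\<delta> (P x) = tmap2 scale P id (\<delta> x) - tmap2 scale id Q (\<delta> x)"
    and \<Delta>_\<Delta>_P_Q: "tensor_id scale \<Delta> (\<Delta> (P x + Q x)) = 0"
    and \<Delta>_mult: "\<Delta> (mul x y) = tmap2 scale (mul x) id (\<Delta> y) + tmap2 scale id (mul y) (\<Delta> x)"
    and \<delta>_br: "\<delta> (br x y) =
      (tmap2 scale (br x) id (\<delta> y) + tmap2 scale id (br x) (\<delta> y)) -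
      (tmap2 scale (br y) id (\<delta> x) + tmap2 scale id (br y) (\<delta> x))"
    and \<delta>_mult: "\<delta> (mul x y) - tmap2 scale id (br y) (\<Delta> x) - tmap2 scale (mul x) id (\<delta> y) -
      tmap2 scale id (br x) (\<Delta> y) - tmap2 scale (mul y) id (\<delta> x) -
      tmap2 scale id Q (\<Delta> (mul x y)) = 0"
    and \<Delta>_br: "\<Delta> (br x y) - tmap2 scale (mul y) id (\<delta> x) - tmap2 scale id (br x) (\<Delta> y) +
      tmap2 scale id (mul y) (\<delta> x) - tmap2 scale (br x) id (\<Delta> y) + \<Delta> (mul (P x) y) = 0"

definition coboundary ::
    "('k::field \<Rightarrow> 'a::ab_group_add \<Rightarrow> 'a) \<Rightarrow> ('a \<Rightarrow> 'a \<Rightarrow> 'a) \<Rightarrow> ('a \<Rightarrow> 'a \<Rightarrow> 'a) \<Rightarrow>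
     ('a \<Rightarrow> ('a \<Rightarrow> 'k) \<Rightarrow> ('a \<Rightarrow> 'k) \<Rightarrow> 'k) \<Rightarrow> ('a \<Rightarrow> ('a \<Rightarrow> 'k) \<Rightarrow> ('a \<Rightarrow> 'k) \<Rightarrow> 'k) \<Rightarrow> bool"
  where "coboundary s mul br \<Delta> \<delta> \<longleftrightarrow> (\<exists>r\<in>tensor2 s. \<forall>x.
    \<Delta> x = tmap2 s id (mul x) r - tmap2 s (mul x) id r \<and>
    \<delta> x = tmap2 s (br x) id r + tmap2 s id (br x) r)"

section \<open>The induced structure on \<open>A \<oplus> A\<^sup>*\<close>\<close>

definition dual_map :: "('a \<Rightarrow> 'b) \<Rightarrow> ('b \<Rightarrow> 'k) \<Rightarrow> 'a \<Rightarrow> 'k"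
  where "dual_map T f = f \<circ> T"

text \<open>The operation \<open>a \<cdot> b = D\<^sup>*(a \<otimes> b)\<close> on \<open>A\<^sup>*\<close> defined by \<open>D : A \<rightarrow> A \<otimes> A\<close>.\<close>

definition dual_op :: "('a \<Rightarrow> ('a \<Rightarrow> 'k) \<Rightarrow> ('a \<Rightarrow> 'k) \<Rightarrow> 'k) \<Rightarrow> ('a \<Rightarrow> 'k) \<Rightarrow> ('a \<Rightarrow> 'k) \<Rightarrow> 'a \<Rightarrow> 'k"
  where "dual_op D a b = (\<lambda>x. D x a b)"

definition dual_rep :: "('x \<Rightarrow> 'v \<Rightarrow> 'v) \<Rightarrow> 'x \<Rightarrow> ('v \<Rightarrow> 'k::uminus) \<Rightarrow> 'v \<Rightarrow> 'k"
  where "dual_rep \<phi> x u = (\<lambda>v. - u (\<phi> x v))"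

text \<open>
  For \<open>\<phi> : A\<^sup>* \<rightarrow> End(A\<^sup>*)\<close>, \<open>dual_rep \<phi> a\<close> acts on \<open>A\<^sup>*\<^sup>*\<close>; \<open>codual_rep\<close> is the corresponding map on \<open>A\<close>
  under the evaluation isomorphism from \<open>A\<close> to \<open>A\<^sup>*\<^sup>*\<close>, which sends \<open>y\<close> to \<open>\<lambda>c. c y\<close>.
\<close>

definition codual_rep :: "('k::field \<Rightarrow> 'a::ab_group_add \<Rightarrow> 'a) \<Rightarrow>
    (('a \<Rightarrow> 'k) \<Rightarrow> ('a \<Rightarrow> 'k) \<Rightarrow> 'a \<Rightarrow> 'k) \<Rightarrow> ('a \<Rightarrow> 'k) \<Rightarrow> 'a \<Rightarrow> 'a"
  where "codual_rep s \<phi> a y =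
    (THE z. \<forall>c\<in>dual_space s. c z = dual_rep \<phi> a (\<lambda>c. c y) c)"

definition double_carrier :: "('k::field \<Rightarrow> 'a::ab_group_add \<Rightarrow> 'a) \<Rightarrow> ('a \<times> ('a \<Rightarrow> 'k)) set"
  where "double_carrier s = UNIV \<times> dual_space s"

definition double_scale :: "('k::field \<Rightarrow> 'a::ab_group_add \<Rightarrow> 'a) \<Rightarrow>
    'k \<Rightarrow> 'a \<times> ('a \<Rightarrow> 'k) \<Rightarrow> 'a \<times> ('a \<Rightarrow> 'k)"
  where "double_scale s c = map_prod (s c) (fun_scale c)"

definition double_mul :: "('k::field \<Rightarrow> 'a::ab_group_add \<Rightarrow> 'a) \<Rightarrow> ('a \<Rightarrow> 'a \<Rightarrow> 'a) \<Rightarrow>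
    ('a \<Rightarrow> ('a \<Rightarrow> 'k) \<Rightarrow> ('a \<Rightarrow> 'k) \<Rightarrow> 'k) \<Rightarrow>
    'a \<times> ('a \<Rightarrow> 'k) \<Rightarrow> 'a \<times> ('a \<Rightarrow> 'k) \<Rightarrow> 'a \<times> ('a \<Rightarrow> 'k)"
  where "double_mul s mul \<Delta> = (\<lambda>(x, a) (y, b).
    (mul x y - codual_rep s (dual_op \<Delta>) a y - codual_rep s (dual_op \<Delta>) b x,
     dual_op \<Delta> a b - dual_rep mul x b - dual_rep mul y a))"

definition double_br :: "('k::field \<Rightarrow> 'a::ab_group_add \<Rightarrow> 'a) \<Rightarrow> ('a \<Rightarrow> 'a \<Rightarrow> 'a) \<Rightarrow>
    ('a \<Rightarrow> ('a \<Rightarrow> 'k) \<Rightarrow> ('a \<Rightarrow> 'k) \<Rightarrow> 'k) \<Rightarrow>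
    'a \<times> ('a \<Rightarrow> 'k) \<Rightarrow> 'a \<times> ('a \<Rightarrow> 'k) \<Rightarrow> 'a \<times> ('a \<Rightarrow> 'k)"
  where "double_br s br \<delta> = (\<lambda>(x, a) (y, b).
    (br x y + codual_rep s (dual_op \<delta>) a y - codual_rep s (dual_op \<delta>) b x,
     dual_op \<delta> a b + dual_rep br x b - dual_rep br y a))"

definition double_form :: "'a \<times> ('a \<Rightarrow> 'k::plus) \<Rightarrow> 'a \<times> ('a \<Rightarrow> 'k) \<Rightarrow> 'k"
  where "double_form = (\<lambda>(x, a) (y, b). b x + a y)"

end

theory Submission
  imports Defs
begin

text \<open>
  The pairing \<open>\<langle>x + a, y + b\<rangle> = b x + a y\<close> on \<open>A \<oplus> A\<^sup>*\<close> is nondegenerate, so an identity in the double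
  may be checked after pairing with one more element. The point of the construction is that the two
  trilinear forms \<open>\<langle>u \<cdot> v, w\<rangle>\<close> and \<open>\<langle>[u, v], w\<rangle>\<close> become, written out in \<open>\<cdot>\<close>, \<open>[-, -]\<close>, \<open>\<Delta>\<close> and \<open>\<delta>\<close>,
  totally symmetric and totally skew-symmetric (\<open>form_mulD\<close>, \<open>form_brD\<close>). This is the invariance of the
  pairing, hence the Frobenius property, and it also turns associativity, the Jacobi identity and the
  relative Leibniz rule into the vanishing of 4-linear forms built from \<open>\<langle>u \<cdot> v, w \<cdot> s\<rangle>\<close>,
  \<open>\<langle>[u, v], [w, s]\<rangle>\<close> and \<open>\<langle>u \<cdot> v, [w, s]\<rangle>\<close> (\<open>form_mulD_exchange\<close>, \<open>form_brD_cyclic\<close>,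
  \<open>form_relative_leibniz\<close>). Sorted by the arguments that come from \<open>A\<^sup>*\<close>, these forms fall apart
  into values of the defects of the bialgebra axioms, which all vanish; for \<open>[w, u \<cdot> v]\<close> paired with \<open>s\<close>,
  where \<open>u\<close>, \<open>v\<close>, \<open>s\<close> come from \<open>A\<^sup>*\<close> and \<open>w\<close> from \<open>A\<close>, the required identity is not an axiom but a
  consequence of several, \<open>cyclic_coleibniz\<close>. In the same way \<open>P + Q\<^sup>*\<close> is a derivation because its
  adjoint for the pairing is \<open>Q + P\<^sup>*\<close>.

  For the unit, \<open>\<langle>(e, 0) \<cdot> (y + b), z + c\<rangle> = c y + b z + \<Delta> e b c\<close> shows that \<open>(e, 0)\<close> is a unit exactly when
  \<open>\<Delta> e = 0\<close>, and the products of a unit with elements of \<open>A\<close> show that no other element can be one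
  (\<open>unit_of_double_iff\<close>). A unital relative Poisson algebra is a Jacobi algebra whose derivation
  is the adjoint action of its unit: put the unit into both factors of the relative Leibniz rule
  (\<open>derivation_eq_ad_unit\<close>). Finally, in the coboundary case \<open>\<Delta> e\<close> is the difference of two
  terms that both equal \<open>r\<close>, since multiplication by \<open>e\<close> is the identity.
\<close>

section \<open>Units and derivations of relative Poisson algebras\<close>

lemma (in fd_space) subspace_V: "subspace V"
  using finite_dim by auto

lemma (in lie_algebra) br_antisymmetric:
  assumes "x \<in> V" "y \<in> V"
  shows "br x y = - br y x"
proof -
  have "x + y \<in> V"
    using assms subspace_V by (simp add: subspace_add)
  then have "br (x + y) (x + y) = br x x + br x y + (br y x + br y y)"
    using br_bilinear assms by (simp add: bilinear_on_def linear_on_def)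
  then show ?thesis
    using assms \<open>x + y \<in> V\<close> by (simp add: br_self eq_neg_iff_add_eq_0)
qed

text \<open>The relative Leibniz rule for \<open>e \<cdot> e\<close> reads \<open>[z, e] = 2 [z, e] + P z\<close>.\<close>
lemma (in relative_poisson_algebra) derivation_eq_ad_unit:
  assumes e: "e \<in> V" and unit: "\<And>x. x \<in> V \<Longrightarrow> mul e x = x" and z: "z \<in> V"
  shows "P z = br e z"
proof -
  have cl: "br z e \<in> V" "P z \<in> V"
    using br_bilinear P_linear e z by (auto simp: bilinear_on_def linear_on_def)
  have "br z e = br z e + br z e + P z"
    using relative_leibniz[OF e e z] unit cl e mult_commute[of "br z e" e] by simp
  then have "P z = - br z e" by (simp add: eq_neg_iff_add_eq_0 add.commute)
  then show ?thesis
    using br_antisymmetric[OF e z] by simp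
qed

lemma (in relative_poisson_algebra) jacobi_algebra_of_unit:
  assumes "e \<in> V" "\<And>x. x \<in> V \<Longrightarrow> mul e x = x"
  shows "jacobi_algebra scale V mul br e"
  by unfold_locales
    (use assms relative_leibniz derivation_eq_ad_unit[OF assms] in simp_all)

lemma relative_poisson_algebra_cong:
  assumes "relative_poisson_algebra s V m b P" and eq: "\<And>x. x \<in> V \<Longrightarrow> P' x = P x"
  shows "relative_poisson_algebra s V m b P'"
proof -
  interpret relative_poisson_algebra s V m b P by fact
  have cl: "m x y \<in> V" "b x y \<in> V" "x + y \<in> V" "s c x \<in> V" if "x \<in> V" "y \<in> V" for x y c
    using that mult_bilinear br_bilinear subspace_V
    by (auto simp: bilinear_on_def linear_on_def subspace_add subspace_scale)
  show ?thesis
  proof unfold_locales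
    show "linear_on s V s V P'"
      using P_linear cl eq by (simp add: linear_on_def)
  qed (use cl eq P_mult P_br relative_leibniz in simp_all)
qed

section \<open>Duality for finite-dimensional spaces\<close>

context vector_space
begin

lemma dual_space_iff:
  "f \<in> dual_space scale \<longleftrightarrow> (\<forall>x y. f (x + y) = f x + f y) \<and> (\<forall>c x. f (scale c x) = c * f x)"
proof -
  have "vector_space ((*) :: 'a \<Rightarrow> 'a \<Rightarrow> 'a)"
    by unfold_locales (simp_all add: algebra_simps)
  then show ?thesis
    by (simp add: dual_space_def Vector_Spaces.linear_iff vector_space_axioms)
qed

lemma dual_space_zero: "0 \<in> dual_space scale"
  by (simp add: dual_space_iff)

lemma functional_add: "f \<in> dual_space scale \<Longrightarrow> f (x + y) = f x + f y"
  and functional_scale: "f \<in> dual_space scale \<Longrightarrow> f (scale c x) = c * f x"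
  by (simp_all add: dual_space_iff)

lemma functional_zero: "f \<in> dual_space scale \<Longrightarrow> f 0 = 0"
  using functional_scale[of f 0 0] by simp

lemma functional_uminus: "f \<in> dual_space scale \<Longrightarrow> f (- x) = - f x"
  using functional_add[of f x "- x"] functional_zero[of f] by (simp add: eq_neg_iff_add_eq_0 add.commute)

lemma functional_diff: "f \<in> dual_space scale \<Longrightarrow> f (x - y) = f x - f y"
  using functional_add[of f x "- y"] functional_uminus[of f y] by simp

lemma functional_sum: "f \<in> dual_space scale \<Longrightarrow> f (\<Sum>i\<in>I. g i) = (\<Sum>i\<in>I. f (g i))"
  by (induction I rule: infinite_finite_induct) (simp_all add: functional_zero functional_add)

lemma dual_space_diff:
  "\<lbrakk>f \<in> dual_space scale; g \<in> dual_space scale\<rbrakk> \<Longrightarrow> f - g \<in> dual_space scale"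
  by (simp add: dual_space_iff algebra_simps)

end

lemma (in fd_space) exists_finite_basis:
  assumes "V = UNIV"
  obtains Basis where "finite_dimensional_vector_space scale Basis"
proof -
  obtain S where S: "finite S" "span S = UNIV"
    using finite_dim assms by blast
  obtain B where B: "B \<subseteq> S" "independent B" "S \<subseteq> span B"
    by (rule maximal_independent_subset)
  have "span B = UNIV"
    using S(2) span_mono[OF B(3)] by (simp add: span_span top.extremum_unique)
  with B S(1) have "finite_dimensional_vector_space scale B"
    by unfold_locales (auto intro: finite_subset)
  then show thesis by (rule that)
qed

locale total_fd_space = fd_space scale UNIV
  for scale :: "'k::field \<Rightarrow> 'a::ab_group_add \<Rightarrow> 'a"
begin

lemma dual_separates:
  assumes "\<And>f. f \<in> dual_space scale \<Longrightarrow> f x = f y"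
  shows "x = y"
proof -
  obtain Basis where "finite_dimensional_vector_space scale Basis"
    by (rule exists_finite_basis) simp
  then interpret fin: finite_dimensional_vector_space scale Basis .
  have coord: "representation Basis x i = representation Basis y i" for i
    using assms fin.coordinate_in_dual_space .
  have expand: "(\<Sum>i\<in>Basis. scale (representation Basis v i) i) = v" for v
    by (rule sum_representation_eq) (auto simp: fin.independent_Basis fin.span_Basis fin.finite_Basis)
  show ?thesis
    by (subst (1 2) expand[symmetric]) (simp only: coord)
qed

text \<open>Reflexivity: evaluating \<open>\<Phi>\<close> on the coordinate functionals of a basis yields the coordinates of
  the representing vector.\<close>
lemma bidual_represented:
  assumes add: "\<And>f g. \<lbrakk>f \<in> dual_space scale; g \<in> dual_space scale\<rbrakk> \<Longrightarrow> \<Phi> (f + g) = \<Phi> f + \<Phi> g"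
    and sc: "\<And>c f. f \<in> dual_space scale \<Longrightarrow> \<Phi> (fun_scale c f) = c * \<Phi> f"
  shows "\<exists>!z. \<forall>f\<in>dual_space scale. f z = \<Phi> f"
proof (rule ex_ex1I)
  obtain Basis where "finite_dimensional_vector_space scale Basis"
    by (rule exists_finite_basis) simp
  then interpret fin: finite_dimensional_vector_space scale Basis .
  let ?c = "\<lambda>i v. representation Basis v i"
  have \<Phi>0: "\<Phi> 0 = 0"
    using sc[OF dual_space_zero, of 0] by (simp add: fun_scale_def zero_fun_def)
  have cl: "(\<Sum>i\<in>I. fun_scale (a i) (?c i)) \<in> dual_space scale" for I a
    by (induction I rule: infinite_finite_induct)
      (simp_all only: sum.infinite sum.empty sum.insert not_False_eq_True dual_space_zero
        dual_space_add dual_space_fun_scale fin.coordinate_in_dual_space)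
  have \<Phi>s: "\<Phi> (\<Sum>i\<in>I. fun_scale (a i) (?c i)) = (\<Sum>i\<in>I. a i * \<Phi> (?c i))" for I a
    by (induction I rule: infinite_finite_induct)
      (simp_all only: sum.infinite sum.empty sum.insert not_False_eq_True \<Phi>0 add sc cl
        dual_space_fun_scale fin.coordinate_in_dual_space)
  have "f (\<Sum>i\<in>Basis. scale (\<Phi> (?c i)) i) = \<Phi> f" if f: "f \<in> dual_space scale" for f
  proof -
    have "f (\<Sum>i\<in>Basis. scale (\<Phi> (?c i)) i) = (\<Sum>i\<in>Basis. f i * \<Phi> (?c i))"
      using f by (simp add: functional_sum functional_scale mult.commute)
    also have "\<dots> = \<Phi> (\<Sum>i\<in>Basis. fun_scale (f i) (?c i))"
      by (simp only: \<Phi>s)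
    also have "\<dots> = \<Phi> f"
      by (simp only: fin.dual_space_expand[OF f, symmetric])
    finally show ?thesis .
  qed
  then show "\<exists>z. \<forall>f\<in>dual_space scale. f z = \<Phi> f" by blast
qed (rule dual_separates, simp)

end

locale comultiplication = total_fd_space scale
  for scale :: "'k::field \<Rightarrow> 'a::ab_group_add \<Rightarrow> 'a" +
  fixes D :: "'a \<Rightarrow> ('a \<Rightarrow> 'k) \<Rightarrow> ('a \<Rightarrow> 'k) \<Rightarrow> 'k"
  assumes D_linear: "linear_on scale UNIV tensor2_scale (tensor2 scale) D"
begin

lemma D_in_tensor2: "D x \<in> tensor2 scale"
  using D_linear by (simp add: linear_on_def)

lemma add_vector: "D (x + y) f g = D x f g + D y f g"
  and scale_vector: "D (scale c x) f g = c * D x f g"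
  using D_linear by (simp_all add: linear_on_def tensor2_scale_def)

lemma add_left: "D x (f + f') g = D x f g + D x f' g"
  and add_right: "D x g (f + f') = D x g f + D x g f'"
  and scale_left': "D x (fun_scale c f) g = c * D x f g"
  and scale_right': "D x g (fun_scale c f) = c * D x g f"
  if "f \<in> dual_space scale" "f' \<in> dual_space scale" "g \<in> dual_space scale"
  using D_in_tensor2[of x] that unfolding tensor2_def bilinear_on_def linear_on_def by auto

lemma diff_left: "D x (f - f') g = D x f g - D x f' g"
  and diff_right: "D x g (f - f') = D x g f - D x g f'"
  if "f \<in> dual_space scale" "f' \<in> dual_space scale" "g \<in> dual_space scale"
  using add_left[of "f - f'" f' g x] add_right[of "f - f'" f' g x] that
  by (simp_all add: dual_space_diff)

lemma zero_left: "g \<in> dual_space scale \<Longrightarrow> D x 0 g = 0"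
  and zero_right: "g \<in> dual_space scale \<Longrightarrow> D x g 0 = 0"
  using diff_left[of g g g x] diff_right[of g g g x] by simp_all

lemma uminus_left: "D x (- f) g = - D x f g"
  and uminus_right: "D x g (- f) = - D x g f"
  if "f \<in> dual_space scale" "g \<in> dual_space scale"
  using diff_left[of 0 f g x] diff_right[of 0 f g x] that
  by (simp_all add: dual_space_zero zero_left zero_right)

lemma dual_op_in_dual_space: "dual_op D f g \<in> dual_space scale"
  using functional_of_comultiplication[OF D_linear] by (simp add: dual_op_def)

text \<open>The action on \<open>A\<close> is only specified through \<open>A\<^sup>*\<^sup>*\<close>; reflexivity makes it concrete.\<close>
lemma codual_rep_pairing:
  assumes "a \<in> dual_space scale" "f \<in> dual_space scale"
  shows "f (codual_rep scale (dual_op D) a y) = - D y a f"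
proof -
  have "\<exists>!z. \<forall>f\<in>dual_space scale. f z = dual_rep (dual_op D) a (\<lambda>c. c y) f"
    by (rule bidual_represented)
      (use assms in \<open>simp_all add: dual_rep_def dual_op_def add_right scale_right'\<close>)
  from theI'[OF this] show ?thesis
    using assms(2) by (simp add: codual_rep_def dual_rep_def dual_op_def)
qed

end

section \<open>The vector space \<open>A \<oplus> A\<^sup>*\<close> and its pairing\<close>

lemma mem_double_carrier: "(x, a) \<in> double_carrier s \<longleftrightarrow> a \<in> dual_space s"
  by (simp add: double_carrier_def)

lemma double_form_Pair: "double_form (x, a) (y, b) = b x + a y"
  by (simp add: double_form_def)

lemma double_scale_Pair: "double_scale s c (x, a) = (s c x, fun_scale c a)"
  by (simp add: double_scale_def)

lemma double_form_commute: "double_form u v = double_form v u" for u :: "'a \<times> ('a \<Rightarrow> 'k::field)"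
  by (cases u; cases v) (simp add: double_form_Pair add.commute)

context total_fd_space
begin

lemma double_add_closed:
  "\<lbrakk>u \<in> double_carrier scale; v \<in> double_carrier scale\<rbrakk> \<Longrightarrow> u + v \<in> double_carrier scale"
  by (cases u; cases v) (simp add: mem_double_carrier dual_space_add)

lemma double_diff_closed:
  "\<lbrakk>u \<in> double_carrier scale; v \<in> double_carrier scale\<rbrakk> \<Longrightarrow> u - v \<in> double_carrier scale"
  by (cases u; cases v) (simp add: mem_double_carrier dual_space_diff)

lemma double_scale_closed:
  "u \<in> double_carrier scale \<Longrightarrow> double_scale scale c u \<in> double_carrier scale"
  by (cases u) (simp add: mem_double_carrier double_scale_Pair dual_space_fun_scale)

lemma double_fd_space: "fd_space (double_scale scale) (double_carrier scale)"
proof -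
  interpret dbl: vector_space "double_scale scale"
    by unfold_locales (auto simp: double_scale_def fun_scale_def fun_eq_iff algebra_simps)
  obtain Basis where "finite_dimensional_vector_space scale Basis"
    by (rule exists_finite_basis) simp
  then interpret fin: finite_dimensional_vector_space scale Basis .
  let ?c = "\<lambda>i v. representation Basis v i"
  define S where "S = (\<lambda>i. (i, 0)) ` Basis \<union> (\<lambda>i. (0, ?c i)) ` Basis"
  have "dbl.span S \<subseteq> double_carrier scale"
  proof (rule dbl.span_minimal)
    show "S \<subseteq> double_carrier scale"
      by (auto simp: S_def mem_double_carrier dual_space_zero fin.coordinate_in_dual_space)
    show "dbl.subspace (double_carrier scale)"
      by (rule dbl.subspaceI)
        (simp_all add: zero_prod_def mem_double_carrier dual_space_zero double_add_closed double_scale_closed)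
  qed
  moreover have "w \<in> dbl.span S" if w: "w \<in> double_carrier scale" for w
  proof -
    obtain x f where w_eq: "w = (x, f)" by (cases w)
    with w have f: "f \<in> dual_space scale" by (simp add: mem_double_carrier)
    have "x = (\<Sum>i\<in>Basis. scale (representation Basis x i) i)"
      by (rule sum_representation_eq[symmetric])
        (auto simp: fin.independent_Basis fin.span_Basis fin.finite_Basis)
    moreover have "fun_scale r (0 :: 'a \<Rightarrow> 'k) = 0" for r
      by (simp add: fun_scale_def fun_eq_iff)
    ultimately have "w = (\<Sum>i\<in>Basis. double_scale scale (representation Basis x i) (i, 0)) +
        (\<Sum>i\<in>Basis. double_scale scale (f i) (0, ?c i))"
      unfolding w_eq using fin.dual_space_expand[OF f]
      by (simp add: prod_eq_iff fst_sum snd_sum double_scale_Pair)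
    also have "\<dots> \<in> dbl.span S"
      by (intro dbl.span_add dbl.span_sum dbl.span_scale dbl.span_base) (auto simp: S_def)
    finally show ?thesis .
  qed
  ultimately have "dbl.span S = double_carrier scale" by blast
  moreover have "finite S" by (simp add: S_def fin.finite_Basis)
  ultimately show ?thesis
    by unfold_locales blast
qed

lemma double_form_add_left:
  assumes "w \<in> double_carrier scale"
  shows "double_form (u + v) w = double_form u w + double_form v w"
  using assms by (cases u; cases v; cases w)
    (simp add: mem_double_carrier double_form_Pair functional_add)

lemma double_form_diff_left:
  assumes "w \<in> double_carrier scale"
  shows "double_form (u - v) w = double_form u w - double_form v w"
  using assms by (cases u; cases v; cases w)
    (simp add: mem_double_carrier double_form_Pair functional_diff)

lemma double_form_scale_left:
  assumes "w \<in> double_carrier scale"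
  shows "double_form (double_scale scale c u) w = c * double_form u w"
  using assms by (cases u; cases w)
    (simp add: mem_double_carrier double_form_Pair double_scale_Pair fun_scale_def functional_scale
      algebra_simps)

lemma double_form_bilinear:
  "bilinear_on (double_scale scale) (double_carrier scale) (*) UNIV double_form"
proof -
  have left: "linear_on (double_scale scale) (double_carrier scale) (*) UNIV (\<lambda>u. double_form u w)"
    if "w \<in> double_carrier scale" for w
    using that by (simp add: linear_on_def double_form_add_left double_form_scale_left)
  moreover have "linear_on (double_scale scale) (double_carrier scale) (*) UNIV (double_form w)"
    if "w \<in> double_carrier scale" for w
    using left[OF that] by (simp only: linear_on_def double_form_commute[of w])
  ultimately show ?thesis by (simp only: bilinear_on_def) blast
qed

lemma double_form_zero_left: "w \<in> double_carrier scale \<Longrightarrow> double_form 0 w = 0"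
  using double_form_diff_left[of w 0 0] by simp

lemma double_form_nondegenerate:
  assumes u: "u \<in> double_carrier scale"
    and 0: "\<And>w. w \<in> double_carrier scale \<Longrightarrow> double_form u w = 0"
  shows "u = 0"
proof -
  obtain x a where ux: "u = (x, a)" by (cases u)
  have "x = 0"
  proof (rule dual_separates)
    fix f assume f: "f \<in> dual_space scale"
    then have a: "a \<in> dual_space scale" using u by (simp add: ux mem_double_carrier)
    show "f x = f 0"
      using 0[of "(0, f)"] f a by (simp add: ux mem_double_carrier double_form_Pair functional_zero)
  qed
  moreover have "a y = 0" for y
    using 0[of "(y, 0)"] by (simp add: ux mem_double_carrier double_form_Pair dual_space_zero)
  ultimately show ?thesis by (simp add: ux zero_prod_def fun_eq_iff)
qed

lemma double_eqI:
  assumes "u \<in> double_carrier scale" "v \<in> double_carrier scale"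
    and "\<And>w. w \<in> double_carrier scale \<Longrightarrow> double_form u w = double_form v w"
  shows "u = v"
  using double_form_nondegenerate[of "u - v"] assms
  by (simp add: double_diff_closed double_form_diff_left)

end

section \<open>The bialgebra identities as identities of functionals\<close>

context relative_poisson_bialgebra
begin

sublocale total_fd_space scale by unfold_locales
sublocale Delta: comultiplication scale \<Delta> by unfold_locales (rule \<Delta>_linear)
sublocale delta: comultiplication scale \<delta> by unfold_locales (rule \<delta>_linear)

abbreviation dual where "dual \<equiv> dual_space scale"

lemma mul_linear: "Vector_Spaces.linear scale scale (mul x)"
  and br_linear: "Vector_Spaces.linear scale scale (br x)"
  and P_linear': "Vector_Spaces.linear scale scale P"
  using mult_bilinear br_bilinear P_linear
  by (simp_all add: Vector_Spaces.linear_iff vector_space_axioms bilinear_on_def linear_on_def)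

lemma dual_closed:
  "f \<in> dual \<Longrightarrow> f \<circ> mul x \<in> dual" "f \<in> dual \<Longrightarrow> f \<circ> br x \<in> dual"
  "f \<in> dual \<Longrightarrow> f \<circ> P \<in> dual" "f \<in> dual \<Longrightarrow> f \<circ> Q \<in> dual"
  "dual_op \<Delta> f g \<in> dual" "dual_op \<delta> f g \<in> dual"
  "\<lbrakk>f \<in> dual; g \<in> dual\<rbrakk> \<Longrightarrow> f + g \<in> dual" "\<lbrakk>f \<in> dual; g \<in> dual\<rbrakk> \<Longrightarrow> f - g \<in> dual"
  "f \<in> dual \<Longrightarrow> fun_scale c f \<in> dual" "0 \<in> dual"
  by (simp_all add: dual_space_comp mul_linear br_linear P_linear' Q_linear
      Delta.dual_op_in_dual_space delta.dual_op_in_dual_space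
      dual_space_add dual_space_diff dual_space_fun_scale dual_space_zero)

lemma mul_commute: "mul x y = mul y x"
  and mul_left_commute: "mul x (mul y z) = mul y (mul x z)"
  and mul_assoc: "mul (mul x y) z = mul x (mul y z)"
proof -
  show comm: "mul x y = mul y x" for x y by (rule mult_commute) simp_all
  show assoc: "mul (mul x y) z = mul x (mul y z)" for x y z by (rule mult_assoc) simp_all
  show "mul x (mul y z) = mul y (mul x z)"
    by (simp only: assoc[symmetric] comm[of x y])
qed

lemma mul_add_right: "mul x (y + z) = mul x y + mul x z"
  and mul_add_left: "mul (x + y) z = mul x z + mul y z"
  and mul_scale_right: "mul x (scale c y) = scale c (mul x y)"
  and mul_scale_left: "mul (scale c x) y = scale c (mul x y)"
  and br_add_right: "br x (y + z) = br x y + br x z"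
  and br_add_left: "br (x + y) z = br x z + br y z"
  and br_scale_right: "br x (scale c y) = scale c (br x y)"
  and br_scale_left: "br (scale c x) y = scale c (br x y)"
  using mult_bilinear br_bilinear by (simp_all add: bilinear_on_def linear_on_def)

lemma br_skew: "br x y = - br y x"
  by (rule br_antisymmetric) simp_all

lemma br_uminus_right: "br x (- y) = - br x y"
  using br_add_right[of x y "- y"] br_add_right[of x 0 0]
  by (simp add: eq_neg_iff_add_eq_0 add.commute)

lemma Delta_commute: "\<Delta> x f g = \<Delta> x g f"
  using \<Delta>_cocommutative[of x] by (metis flip2_def)

lemma delta_skew: "\<delta> x f g = - \<delta> x g f"
  using \<delta>_skew[of x] by (metis flip2_def fun_Compl_def)

lemma Delta_op_commute: "dual_op \<Delta> f g = dual_op \<Delta> g f"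
  unfolding dual_op_def by (rule ext) (rule Delta_commute)

lemma delta_op_skew: "dual_op \<delta> f g = - dual_op \<delta> g f"
  unfolding dual_op_def by (rule ext) (simp add: delta_skew[of _ f g])

context
  fixes f g h :: "'a \<Rightarrow> 'k"
  assumes fgh: "f \<in> dual" "g \<in> dual" "h \<in> dual"
begin

text \<open>Evaluated on functionals, a map \<open>S \<otimes> T\<close> becomes precomposition with \<open>S\<close> and \<open>T\<close>, and \<open>id \<otimes> D\<close> becomes
  the operation dual to \<open>D\<close>. The conditions are kept in the form \<open>t = 0\<close> because their left-hand sides
  are the summands into which the 4-linear forms on the double decompose.\<close>
lemma coassociativity: "\<Delta> x f (dual_op \<Delta> g h) - \<Delta> x (dual_op \<Delta> f g) h = 0"
  using fun_cong[OF fun_cong[OF fun_cong[OF \<Delta>_coassociative[of x]]], of f g h] fgh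
  by (simp add: id_tensor_def tensor_id_def ext3_def dual_op_def)

lemma cojacobi:
  "\<delta> x f (dual_op \<delta> g h) + \<delta> x h (dual_op \<delta> f g) + \<delta> x g (dual_op \<delta> h f) = 0"
  using fun_cong[OF fun_cong[OF fun_cong[OF \<delta>_cojacobi[of x]]], of f g h] fgh
  by (simp add: id_tensor_def ext3_def dual_op_def cycle3_def)

lemma coleibniz:
  "\<delta> x f (dual_op \<Delta> g h) - \<Delta> x (dual_op \<delta> f g) h - \<Delta> x g (dual_op \<delta> f h) -
    \<Delta> x (dual_op \<Delta> (f \<circ> Q) g) h = 0"
  using fun_cong[OF fun_cong[OF fun_cong[OF relative_coleibniz[of x]]], of f g h] fgh
  by (simp add: id_tensor_def tensor_id_def ext3_def dual_op_def flip12_def tmap3_def dual_closed)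

lemma Delta_Delta_P_Q: "\<Delta> (P x) (dual_op \<Delta> f g) h + \<Delta> (Q x) (dual_op \<Delta> f g) h = 0"
  using fun_cong[OF fun_cong[OF fun_cong[OF \<Delta>_\<Delta>_P_Q[of x]]], of f g h] fgh
  by (simp add: tensor_id_def ext3_def dual_op_def Delta.add_vector)

end

context
  fixes f g :: "'a \<Rightarrow> 'k"
  assumes fg: "f \<in> dual" "g \<in> dual"
begin

lemma Delta_Q: "\<Delta> (Q x) f g = \<Delta> x (f \<circ> Q) g + \<Delta> x f (g \<circ> Q)"
  and delta_Q: "\<delta> (Q x) f g = \<delta> x (f \<circ> Q) g + \<delta> x f (g \<circ> Q)"
  and Delta_P: "\<Delta> (P x) f g = \<Delta> x (f \<circ> P) g - \<Delta> x f (g \<circ> Q)"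
  and delta_P: "\<delta> (P x) f g = \<delta> x (f \<circ> P) g - \<delta> x f (g \<circ> Q)"
  using fg by (simp_all add: \<Delta>_Q \<delta>_Q \<Delta>_P \<delta>_P tmap2_def ext2_def)

lemma Delta_mul: "\<Delta> (mul x y) f g - \<Delta> y (f \<circ> mul x) g - \<Delta> x f (g \<circ> mul y) = 0"
  using fg by (simp add: \<Delta>_mult tmap2_def ext2_def)

lemma delta_br:
  "\<delta> (br x y) f g - \<delta> y (f \<circ> br x) g - \<delta> y f (g \<circ> br x) +
    \<delta> x (f \<circ> br y) g + \<delta> x f (g \<circ> br y) = 0"
  using fg by (simp add: \<delta>_br tmap2_def ext2_def)

lemma delta_mul:
  "\<delta> (mul x y) f g - \<Delta> x f (g \<circ> br y) - \<delta> y (f \<circ> mul x) g - \<Delta> y f (g \<circ> br x) -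
    \<delta> x (f \<circ> mul y) g - \<Delta> (mul x y) f (g \<circ> Q) = 0"
  using fun_cong[OF fun_cong[OF \<delta>_mult[of x y]], of f g] fg
  by (simp add: tmap2_def ext2_def)

lemma Delta_br:
  "\<Delta> (br x y) f g - \<delta> x (f \<circ> mul y) g - \<Delta> y f (g \<circ> br x) + \<delta> x f (g \<circ> mul y) -
    \<Delta> y (f \<circ> br x) g + \<Delta> (mul (P x) y) f g = 0"
  using fun_cong[OF fun_cong[OF \<Delta>_br[of x y]], of f g] fg
  by (simp add: tmap2_def ext2_def)

end

text \<open>The dual of the last condition for \<open>Q\<close> to represent \<open>(A, P)\<close> dually: \<open>P\<^sup>*\<close> satisfies it on
  \<open>A\<^sup>*\<close>. In the cyclic sum of the co-Leibniz identity all bracket terms cancel, the remaining terms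
  add up to \<open>Q\<^sup>*\<close> of a triple product, and there \<open>Q\<^sup>*\<close> agrees with \<open>- P\<^sup>*\<close>.\<close>
lemma cyclic_coleibniz:
  assumes fgh: "f \<in> dual" "g \<in> dual" "h \<in> dual"
  shows
  "\<delta> x f (dual_op \<Delta> g h) + \<delta> x g (dual_op \<Delta> h f) + \<delta> x h (dual_op \<Delta> f g) +
    \<Delta> (P x) f (dual_op \<Delta> g h) = 0"
proof -
  note closed = fgh dual_closed
  have d: "\<delta> x f (dual_op \<Delta> g h) = \<Delta> x (dual_op \<delta> f g) h + \<Delta> x g (dual_op \<delta> f h) +
      \<Delta> x (dual_op \<Delta> (f \<circ> Q) g) h" if "f \<in> dual" "g \<in> dual" "h \<in> dual" for f g h
    using coleibniz[OF that, of x] by (simp add: algebra_simps)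
  have ca: "\<Delta> x f (dual_op \<Delta> g h) = \<Delta> x (dual_op \<Delta> f g) h"
    if "f \<in> dual" "g \<in> dual" "h \<in> dual" for f g h
    using coassociativity[OF that, of x] by simp
  have Qop: "dual_op \<Delta> g h \<circ> Q = dual_op \<Delta> (g \<circ> Q) h + dual_op \<Delta> g (h \<circ> Q)"
    using Delta_Q[OF fgh(2,3)] by (simp add: dual_op_def fun_eq_iff)
  have "\<Delta> (P x) f (dual_op \<Delta> g h) = - \<Delta> (Q x) (dual_op \<Delta> g h) f"
    using Delta_Delta_P_Q[OF fgh(2,3,1), of x] by (simp add: Delta_commute[of _ f] eq_neg_iff_add_eq_0)
  also have "\<dots> = - (\<Delta> x (dual_op \<Delta> (g \<circ> Q) h) f + \<Delta> x (dual_op \<Delta> (h \<circ> Q) g) f +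
      \<Delta> x (f \<circ> Q) (dual_op \<Delta> g h))"
    by (simp add: Delta_Q closed Qop Delta.add_left Delta_commute[of _ _ "f \<circ> Q"]
        Delta_op_commute[of g "h \<circ> Q"])
  also have "\<dots> = - (\<Delta> x (dual_op \<Delta> (g \<circ> Q) h) f + \<Delta> x (dual_op \<Delta> (h \<circ> Q) f) g +
      \<Delta> x (dual_op \<Delta> (f \<circ> Q) g) h)"
    using ca[of "h \<circ> Q" g f] ca[of "h \<circ> Q" f g] ca[of "f \<circ> Q" g h] closed
    by (simp add: Delta_op_commute[of g f])
  finally have DP: "\<Delta> (P x) f (dual_op \<Delta> g h) = \<dots>" .
  show ?thesis
    unfolding DP d[OF fgh] d[OF fgh(2,3,1)] d[OF fgh(3,1,2)]
      delta_op_skew[of g f] delta_op_skew[of h g] delta_op_skew[of h f]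
    by (simp add: Delta.uminus_left Delta.uminus_right closed Delta_commute)
qed

lemma dually_represents_mul: "f \<in> dual \<Longrightarrow> f (mul x (Q y)) - f (mul (P x) y) - f (Q (mul x y)) = 0"
  and dually_represents_br: "f \<in> dual \<Longrightarrow> f (br x (Q y)) - f (br (P x) y) - f (Q (br x y)) = 0"
  and dually_represents_br_mul: "f \<in> dual \<Longrightarrow>
    f (br x (mul y z)) + f (br y (mul z x)) + f (br z (mul x y)) + f (Q (mul x (mul y z))) = 0"
proof -
  assume f: "f \<in> dual"
  note Q_rep = Q_dually_represents[unfolded dually_represents_def mul_assoc]
  have "f (mul x (Q y) - mul (P x) y - Q (mul x y)) = f 0"
    using Q_rep by (intro arg_cong[of _ _ f]) blast
  then show "f (mul x (Q y)) - f (mul (P x) y) - f (Q (mul x y)) = 0"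
    by (simp only: functional_diff[OF f] functional_zero[OF f])
next
  assume f: "f \<in> dual"
  note Q_rep = Q_dually_represents[unfolded dually_represents_def mul_assoc]
  have "f (br x (Q y) - br (P x) y - Q (br x y)) = f 0"
    using Q_rep by (intro arg_cong[of _ _ f]) blast
  then show "f (br x (Q y)) - f (br (P x) y) - f (Q (br x y)) = 0"
    by (simp only: functional_diff[OF f] functional_zero[OF f])
next
  assume f: "f \<in> dual"
  note Q_rep = Q_dually_represents[unfolded dually_represents_def mul_assoc]
  have "f (br x (mul y z) + br y (mul z x) + br z (mul x y) + Q (mul x (mul y z))) = f 0"
    using Q_rep by (intro arg_cong[of _ _ f]) blast
  then show "f (br x (mul y z)) + f (br y (mul z x)) + f (br z (mul x y)) + f (Q (mul x (mul y z))) = 0"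
    by (simp only: functional_add[OF f] functional_zero[OF f])
qed

end

section \<open>The pairing on products and brackets\<close>

context relative_poisson_bialgebra
begin

abbreviation D where "D \<equiv> double_carrier scale"
abbreviation sD where "sD \<equiv> double_scale scale"
abbreviation mulD where "mulD \<equiv> double_mul scale mul \<Delta>"
abbreviation brD where "brD \<equiv> double_br scale br \<delta>"
abbreviation PD where "PD \<equiv> map_prod P (dual_map Q)"
abbreviation form (\<open>\<langle>_, _\<rangle>\<close>) where "form u v \<equiv> double_form u v"

lemma snd_mulD: "snd (mulD (x, a) (y, b)) = dual_op \<Delta> a b + (b \<circ> mul x) + (a \<circ> mul y)"
  by (simp add: double_mul_def dual_rep_def fun_eq_iff)

lemma snd_brD: "snd (brD (x, a) (y, b)) = dual_op \<delta> a b - (b \<circ> br x) + (a \<circ> br y)"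
  by (simp add: double_br_def dual_rep_def fun_eq_iff)

lemma functional_fst_mulD:
  assumes "a \<in> dual" "b \<in> dual" "f \<in> dual"
  shows "f (fst (mulD (x, a) (y, b))) = f (mul x y) + \<Delta> y a f + \<Delta> x b f"
  using assms by (simp add: double_mul_def functional_diff Delta.codual_rep_pairing)

lemma functional_fst_brD:
  assumes "a \<in> dual" "b \<in> dual" "f \<in> dual"
  shows "f (fst (brD (x, a) (y, b))) = f (br x y) - \<delta> y a f + \<delta> x b f"
  using assms
  by (simp add: double_br_def functional_diff functional_add delta.codual_rep_pairing)

lemma mulD_closed: "\<lbrakk>u \<in> D; v \<in> D\<rbrakk> \<Longrightarrow> mulD u v \<in> D"
  by (cases u; cases v)
    (simp add: double_carrier_def mem_Times_iff snd_mulD dual_closed)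

lemma brD_closed: "\<lbrakk>u \<in> D; v \<in> D\<rbrakk> \<Longrightarrow> brD u v \<in> D"
  by (cases u; cases v)
    (simp add: double_carrier_def mem_Times_iff snd_brD dual_closed)

lemma PD_closed: "u \<in> D \<Longrightarrow> PD u \<in> D"
  by (cases u) (simp add: mem_double_carrier dual_map_def dual_closed)

lemmas double_closed = mulD_closed brD_closed PD_closed

lemma form_eq: "double_form u (z, c) = c (fst u) + snd u z"
  by (cases u) (simp add: double_form_Pair)

text \<open>Under simultaneous permutations of the three pairs, the right-hand side below is symmetric because
  \<open>\<cdot>\<close> and \<open>\<Delta>\<close> are; the corresponding expression for the bracket is skew-symmetric.\<close>
lemma form_mulD:
  assumes "a \<in> dual" "b \<in> dual" "c \<in> dual"
  shows "\<langle>mulD (x, a) (y, b), (z, c)\<rangle> =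
    c (mul x y) + \<Delta> y a c + \<Delta> x b c + \<Delta> z a b + b (mul x z) + a (mul y z)"
  using assms by (simp add: form_eq functional_fst_mulD snd_mulD dual_op_def)

lemma form_brD:
  assumes "a \<in> dual" "b \<in> dual" "c \<in> dual"
  shows "\<langle>brD (x, a) (y, b), (z, c)\<rangle> =
    c (br x y) - \<delta> y a c + \<delta> x b c + \<delta> z a b - b (br x z) + a (br y z)"
  using assms by (simp add: form_eq functional_fst_brD snd_brD dual_op_def)

lemma mulD_commute: "mulD u v = mulD v u"
  by (cases u; cases v) (auto simp: double_mul_def mul_commute Delta_op_commute algebra_simps)

lemma form_mulD_invariant:
  assumes "u \<in> D" "v \<in> D" "w \<in> D"
  shows "\<langle>mulD u v, w\<rangle> = \<langle>u, mulD v w\<rangle>"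
proof -
  obtain x a y b z c where eq: "u = (x, a)" "v = (y, b)" "w = (z, c)"
    by (cases u; cases v; cases w)
  then have "a \<in> dual" "b \<in> dual" "c \<in> dual"
    using assms by (simp_all add: mem_double_carrier)
  then show ?thesis
    unfolding eq double_form_commute[of "(x, a)"]
    by (simp add: form_mulD mul_commute[of z x] mul_commute[of y x] Delta_commute algebra_simps)
qed

lemma form_brD_invariant:
  assumes "u \<in> D" "v \<in> D" "w \<in> D"
  shows "\<langle>brD u v, w\<rangle> = \<langle>u, brD v w\<rangle>"
proof -
  obtain x a y b z c where eq: "u = (x, a)" "v = (y, b)" "w = (z, c)"
    by (cases u; cases v; cases w)
  then have "a \<in> dual" "b \<in> dual" "c \<in> dual"
    using assms by (simp_all add: mem_double_carrier)
  then show ?thesis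
    unfolding eq double_form_commute[of "(x, a)"]
    by (simp add: form_brD br_skew[of z x] br_skew[of y x] delta_skew[of z b a] delta_skew[of y c a]
        functional_uminus algebra_simps)
qed

lemma brD_skew:
  assumes "u \<in> D" "v \<in> D"
  shows "brD u v = - brD v u"
proof -
  obtain x a y b where eq: "u = (x, a)" "v = (y, b)"
    by (cases u; cases v)
  have "brD u v + brD v u = 0"
    unfolding eq by (simp add: double_br_def zero_prod_def br_skew[of x y] delta_op_skew[of a b])
  then show ?thesis by (simp add: eq_neg_iff_add_eq_0)
qed

lemma dual_op_apply: "dual_op \<Gamma> f g x = \<Gamma> x f g"
  by (simp add: dual_op_def)

lemma form_mulD_mulD:
  assumes "a \<in> dual" "b \<in> dual" "c \<in> dual" "d \<in> dual"
  shows "\<langle>mulD (x, a) (y, b), mulD (z, c) (t, d)\<rangle> =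
    \<Delta> (mul x y) c d + \<Delta> y a (dual_op \<Delta> c d) + \<Delta> x b (dual_op \<Delta> c d) +
    d (mul z (mul x y)) + \<Delta> y a (d \<circ> mul z) + \<Delta> x b (d \<circ> mul z) +
    c (mul t (mul x y)) + \<Delta> y a (c \<circ> mul t) + \<Delta> x b (c \<circ> mul t) +
    \<Delta> (mul z t) a b + \<Delta> t c (dual_op \<Delta> a b) + \<Delta> z d (dual_op \<Delta> a b) +
    b (mul x (mul z t)) + \<Delta> t c (b \<circ> mul x) + \<Delta> z d (b \<circ> mul x) +
    a (mul y (mul z t)) + \<Delta> t c (a \<circ> mul y) + \<Delta> z d (a \<circ> mul y)"
proof -
  define p q where "p = fst (mulD (z, c) (t, d))" and "q = snd (mulD (z, c) (t, d))"
  have q: "q = dual_op \<Delta> c d + (d \<circ> mul z) + (c \<circ> mul t)"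
    by (simp add: q_def snd_mulD)
  have p: "f p = f (mul z t) + \<Delta> t c f + \<Delta> z d f" if "f \<in> dual" for f
    using that assms by (simp add: p_def functional_fst_mulD)
  have "\<langle>mulD (x, a) (y, b), mulD (z, c) (t, d)\<rangle> = \<langle>mulD (x, a) (y, b), (p, q)\<rangle>"
    by (simp add: p_def q_def)
  also have "\<dots> = q (mul x y) + \<Delta> y a q + \<Delta> x b q +
      dual_op \<Delta> a b p + (b \<circ> mul x) p + (a \<circ> mul y) p"
    using assms by (simp add: form_mulD q dual_closed dual_op_apply)
  finally show ?thesis
    using assms unfolding p[OF dual_closed(5)] p[OF dual_closed(1)[OF assms(1)]] p[OF dual_closed(1)[OF assms(2)]]
    by (simp add: q dual_closed Delta.add_right dual_op_apply algebra_simps)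
qed

lemma form_brD_brD:
  assumes "a \<in> dual" "b \<in> dual" "c \<in> dual" "d \<in> dual"
  shows "\<langle>brD (x, a) (y, b), brD (z, c) (t, d)\<rangle> =
    \<delta> (br x y) c d - \<delta> y a (dual_op \<delta> c d) + \<delta> x b (dual_op \<delta> c d) -
    d (br z (br x y)) + \<delta> y a (d \<circ> br z) - \<delta> x b (d \<circ> br z) +
    c (br t (br x y)) - \<delta> y a (c \<circ> br t) + \<delta> x b (c \<circ> br t) +
    \<delta> (br z t) a b - \<delta> t c (dual_op \<delta> a b) + \<delta> z d (dual_op \<delta> a b) -
    b (br x (br z t)) + \<delta> t c (b \<circ> br x) - \<delta> z d (b \<circ> br x) +
    a (br y (br z t)) - \<delta> t c (a \<circ> br y) + \<delta> z d (a \<circ> br y)"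
proof -
  define p q where "p = fst (brD (z, c) (t, d))" and "q = snd (brD (z, c) (t, d))"
  have q: "q = dual_op \<delta> c d - (d \<circ> br z) + (c \<circ> br t)"
    by (simp add: q_def snd_brD)
  have p: "f p = f (br z t) - \<delta> t c f + \<delta> z d f" if "f \<in> dual" for f
    using that assms by (simp add: p_def functional_fst_brD)
  have "\<langle>brD (x, a) (y, b), brD (z, c) (t, d)\<rangle> = \<langle>brD (x, a) (y, b), (p, q)\<rangle>"
    by (simp add: p_def q_def)
  also have "\<dots> = q (br x y) - \<delta> y a q + \<delta> x b q +
      dual_op \<delta> a b p - (b \<circ> br x) p + (a \<circ> br y) p"
    using assms by (simp add: form_brD q dual_closed dual_op_apply)
  finally show ?thesis
    using assms unfolding p[OF dual_closed(6)] p[OF dual_closed(2)[OF assms(1)]] p[OF dual_closed(2)[OF assms(2)]]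
    by (simp add: q dual_closed delta.add_right delta.diff_right dual_op_apply algebra_simps)
qed

lemma form_mulD_brD:
  assumes "a \<in> dual" "b \<in> dual" "c \<in> dual" "d \<in> dual"
  shows "\<langle>mulD (x, a) (y, b), brD (z, c) (t, d)\<rangle> =
    \<delta> (mul x y) c d + \<Delta> y a (dual_op \<delta> c d) + \<Delta> x b (dual_op \<delta> c d) -
    d (br z (mul x y)) - \<Delta> y a (d \<circ> br z) - \<Delta> x b (d \<circ> br z) +
    c (br t (mul x y)) + \<Delta> y a (c \<circ> br t) + \<Delta> x b (c \<circ> br t) +
    \<Delta> (br z t) a b - \<delta> t c (dual_op \<Delta> a b) + \<delta> z d (dual_op \<Delta> a b) +
    b (mul x (br z t)) - \<delta> t c (b \<circ> mul x) + \<delta> z d (b \<circ> mul x) +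
    a (mul y (br z t)) - \<delta> t c (a \<circ> mul y) + \<delta> z d (a \<circ> mul y)"
proof -
  define p q where "p = fst (brD (z, c) (t, d))" and "q = snd (brD (z, c) (t, d))"
  have q: "q = dual_op \<delta> c d - (d \<circ> br z) + (c \<circ> br t)"
    by (simp add: q_def snd_brD)
  have p: "f p = f (br z t) - \<delta> t c f + \<delta> z d f" if "f \<in> dual" for f
    using that assms by (simp add: p_def functional_fst_brD)
  have "\<langle>mulD (x, a) (y, b), brD (z, c) (t, d)\<rangle> = \<langle>mulD (x, a) (y, b), (p, q)\<rangle>"
    by (simp add: p_def q_def)
  also have "\<dots> = q (mul x y) + \<Delta> y a q + \<Delta> x b q +
      dual_op \<Delta> a b p + (b \<circ> mul x) p + (a \<circ> mul y) p"
    using assms by (simp add: form_mulD q dual_closed dual_op_apply)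
  finally show ?thesis
    using assms unfolding p[OF dual_closed(5)] p[OF dual_closed(1)[OF assms(1)]] p[OF dual_closed(1)[OF assms(2)]]
    by (simp add: q dual_closed Delta.add_right Delta.diff_right dual_op_apply algebra_simps)
qed

section \<open>The 4-linear identities\<close>

text \<open>By commutativity and invariance, this exchange rule is associativity paired with a fourth
  element. Its parts with one, two and three arguments from \<open>A\<^sup>*\<close> are associativity of \<open>A\<close>, the
  cocycle condition for \<open>\<Delta>\<close> and coassociativity.\<close>
lemma form_mulD_exchange:
  assumes "u \<in> D" "v \<in> D" "w \<in> D" "s \<in> D"
  shows "\<langle>mulD u v, mulD w s\<rangle> = \<langle>mulD v w, mulD u s\<rangle>"
proof -
  obtain x a y b z c t d where eq: "u = (x, a)" "v = (y, b)" "w = (z, c)" "s = (t, d)"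
    by (cases u; cases v; cases w; cases s)
  then have dual: "a \<in> dual" "b \<in> dual" "c \<in> dual" "d \<in> dual"
    using assms by (simp_all add: mem_double_carrier)
  let ?m = "\<lambda>x y f g. \<Delta> (mul x y) f g - \<Delta> y (f \<circ> mul x) g - \<Delta> x f (g \<circ> mul y)"
  let ?ca = "\<lambda>x f g h. \<Delta> x f (dual_op \<Delta> g h) - \<Delta> x (dual_op \<Delta> f g) h"
  \<comment> \<open>\<open>m\<close> and \<open>ca\<close> are the defects of the cocycle condition and of coassociativity. For each pair of
    arguments from \<open>A\<close> there are one or two instances of \<open>m\<close>; two are needed to exchange the factors
    when neither side contains the product of the pair.\<close>
  have "\<langle>mulD u v, mulD w s\<rangle> - \<langle>mulD v w, mulD u s\<rangle> =
      ?m x y d c + ?m z t b a - ?m y z a d - ?m x t b c + ?m x z d b - ?m x z b d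
      + ?m y t c a - ?m y t a c + ?ca t c b a + ?ca x b c d + ?ca y a d c + ?ca z d a b"
    unfolding eq
    by (simp add: form_mulD_mulD dual mul_commute mul_left_commute mul_assoc Delta_commute
        Delta_op_commute algebra_simps)
  also have "\<dots> = 0"
    by (simp only: Delta_mul coassociativity dual add_0 diff_self)
  finally show ?thesis by simp
qed

text \<open>By invariance this is the Jacobiator paired with a fourth element. It is skew in all four
  arguments; its parts with one, two and three arguments from \<open>A\<^sup>*\<close> are the Jacobi identity, the
  cocycle condition for \<open>\<delta>\<close> and the co-Jacobi identity.\<close>
lemma form_brD_cyclic:
  assumes "u \<in> D" "v \<in> D" "w \<in> D" "s \<in> D"
  shows "\<langle>brD v w, brD s u\<rangle> + \<langle>brD w u, brD s v\<rangle> + \<langle>brD u v, brD s w\<rangle> = 0"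
proof -
  obtain x a y b z c t d where eq: "u = (x, a)" "v = (y, b)" "w = (z, c)" "s = (t, d)"
    by (cases u; cases v; cases w; cases s)
  then have dual: "a \<in> dual" "b \<in> dual" "c \<in> dual" "d \<in> dual"
    using assms by (simp_all add: mem_double_carrier)
  let ?b = "\<lambda>x y f g. \<delta> (br x y) f g - \<delta> y (f \<circ> br x) g - \<delta> y f (g \<circ> br x) +
    \<delta> x (f \<circ> br y) g + \<delta> x f (g \<circ> br y)"
  let ?j = "\<lambda>x y z f. f (br x (br y z)) + f (br y (br z x)) + f (br z (br x y))"
  let ?cj = "\<lambda>x f g h. \<delta> x f (dual_op \<delta> g h) + \<delta> x h (dual_op \<delta> f g) + \<delta> x g (dual_op \<delta> h f)"
  have j: "?j x y z f = 0" if "f \<in> dual" for x y z f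
    using br_jacobi[of x y z] functional_zero[OF that] by (simp flip: functional_add[OF that])
  have skew: "\<delta> x (f \<circ> br y) g = - \<delta> x g (f \<circ> br y)" for x y f g
    by (rule delta_skew)
  \<comment> \<open>The defects of the cocycle condition (\<open>b\<close>), the Jacobi identity (\<open>j\<close>) and the co-Jacobi identity
    (\<open>cj\<close>) run through the choices of two, one and three arguments from \<open>A\<^sup>*\<close>.\<close>
  have "\<langle>brD v w, brD s u\<rangle> + \<langle>brD w u, brD s v\<rangle> + \<langle>brD u v, brD s w\<rangle> =
      ?b y z d a + ?b t x b c + ?b z x d b + ?b t y c a + ?b x y d c + ?b t z a b
      + ?j x y z d - ?j t y z a - ?j t z x b - ?j t x y c
      - ?cj x d b c - ?cj y d c a - ?cj z d a b + ?cj t a b c"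
    unfolding eq skew
    by (simp add: form_brD_brD dual delta_op_skew[of b a] delta_op_skew[of c a] delta_op_skew[of d a]
        delta_op_skew[of c b] delta_op_skew[of d b] delta_op_skew[of d c]
        br_skew[of y x] br_skew[of z x] br_skew[of t x] br_skew[of z y] br_skew[of t y] br_skew[of t z]
        br_uminus_right functional_add functional_uminus delta.uminus_right dual_closed algebra_simps)
  also have "\<dots> = 0"
    by (simp only: j delta_br cojacobi dual add_0 diff_self)
  finally show ?thesis .
qed

text \<open>By invariance this is the relative Leibniz rule for \<open>[w, u \<cdot> v]\<close> paired with \<open>s\<close>, up to the sign.
  In this form it is symmetric in \<open>u\<close>, \<open>v\<close>, \<open>s\<close>, so only the number of these that lie in \<open>A\<^sup>*\<close>
  matters. For \<open>w\<close> in \<open>A\<close>, one, two and three such arguments give the relative Leibniz rule of \<open>A\<close>, the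
  compatibility condition for \<open>\<Delta> [w, -]\<close> and the cyclic co-Leibniz identity; for \<open>w\<close> in \<open>A\<^sup>*\<close>, none, one
  and two give the last condition on \<open>Q\<close>, the compatibility condition for \<open>\<delta> (x \<cdot> y)\<close> and the
  co-Leibniz identity. The cocycle condition for \<open>\<Delta>\<close> and coassociativity bring the terms with \<open>P\<close> and
  \<open>Q\<close> into the shape that these identities ask for.\<close>
lemma form_relative_leibniz:
  assumes "u \<in> D" "v \<in> D" "w \<in> D" "s \<in> D"
  shows "\<langle>mulD u v, brD w s\<rangle> + \<langle>mulD v s, brD w u\<rangle> + \<langle>mulD s u, brD w v\<rangle> +
    \<langle>mulD u (PD w), mulD v s\<rangle> = 0"
proof -
  obtain x a y b z c t d where eq: "u = (x, a)" "v = (y, b)" "w = (z, c)" "s = (t, d)"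
    by (cases u; cases v; cases w; cases s)
  then have dual: "a \<in> dual" "b \<in> dual" "c \<in> dual" "d \<in> dual"
    using assms by (simp_all add: mem_double_carrier)
  let ?m = "\<lambda>x y f g. \<Delta> (mul x y) f g - \<Delta> y (f \<circ> mul x) g - \<Delta> x f (g \<circ> mul y)"
  let ?ca = "\<lambda>x f g h. \<Delta> x f (dual_op \<Delta> g h) - \<Delta> x (dual_op \<Delta> f g) h"
  let ?cl = "\<lambda>x f g h. \<delta> x f (dual_op \<Delta> g h) - \<Delta> x (dual_op \<delta> f g) h -
    \<Delta> x g (dual_op \<delta> f h) - \<Delta> x (dual_op \<Delta> (f \<circ> Q) g) h"
  let ?ct = "\<lambda>x f g h. \<delta> x f (dual_op \<Delta> g h) + \<delta> x g (dual_op \<Delta> h f) + \<delta> x h (dual_op \<Delta> f g) +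
    \<Delta> (P x) f (dual_op \<Delta> g h)"
  let ?dm = "\<lambda>x y f g. \<delta> (mul x y) f g - \<Delta> x f (g \<circ> br y) - \<delta> y (f \<circ> mul x) g -
    \<Delta> y f (g \<circ> br x) - \<delta> x (f \<circ> mul y) g - \<Delta> (mul x y) f (g \<circ> Q)"
  let ?db = "\<lambda>x y f g. \<Delta> (br x y) f g - \<delta> x (f \<circ> mul y) g - \<Delta> y f (g \<circ> br x) +
    \<delta> x f (g \<circ> mul y) - \<Delta> y (f \<circ> br x) g + \<Delta> (mul (P x) y) f g"
  let ?l = "\<lambda>z x y f. f (br z (mul x y)) - f (mul (br z x) y) - f (mul x (br z y)) -
    f (mul (mul x y) (P z))"
  let ?q = "\<lambda>x y z f. f (br x (mul y z)) + f (br y (mul z x)) + f (br z (mul x y)) +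
    f (Q (mul x (mul y z)))"
  have l: "?l z x y f = 0" if "f \<in> dual" for z x y f
    using relative_leibniz[of x y z] by (simp add: functional_add[OF that])
  have skew: "\<delta> x (f \<circ> mul y) g = - \<delta> x g (f \<circ> mul y)" for x y f g
    by (rule delta_skew)
  \<comment> \<open>The instances of \<open>m\<close> and \<open>ca\<close> rewrite the terms with \<open>P z\<close> and \<open>c \<circ> Q\<close>; the other defects run
    through the choices of the arguments that come from \<open>A\<^sup>*\<close>.\<close>
  have "\<langle>mulD u v, brD w s\<rangle> + \<langle>mulD v s, brD w u\<rangle> + \<langle>mulD s u, brD w v\<rangle> +
      \<langle>mulD u (PD w), mulD v s\<rangle> =
      - ?m y (P z) d a - ?m t (P z) b a - ?m x y (c \<circ> Q) d - ?m x t (c \<circ> Q) b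
      + ?ca x (c \<circ> Q) b d - ?cl x c b d - ?cl t c a b - ?cl y c a d
      + ?db z x b d + ?db z y d a + ?db z t a b - ?dm x y d c - ?dm y t a c - ?dm t x b c
      - ?l z x y d - ?l z y t a - ?l z t x b + ?q x y t c + ?ct z a b d"
    unfolding eq skew
    by (simp add: form_mulD_mulD form_mulD_brD dual delta_skew[of "mul _ _" c]
        delta_op_skew[of c a] delta_op_skew[of c b] delta_op_skew[of d c]
        dual_map_def delta.uminus_left Delta.uminus_left Delta.uminus_right functional_diff dual_closed
        mul_commute mul_left_commute mul_assoc Delta_commute Delta_op_commute algebra_simps)
  also have "\<dots> = 0"
    by (simp only: l Delta_mul coassociativity coleibniz cyclic_coleibniz delta_mul Delta_br
        dually_represents_br_mul dual dual_closed add_0 diff_self minus_zero)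
  finally show ?thesis .
qed

end

section \<open>The double is a relative Poisson algebra\<close>

context relative_poisson_bialgebra
begin

lemma linear_on_doubleI:
  assumes "\<And>u. u \<in> D \<Longrightarrow> h u \<in> D"
    and "\<And>u v w. \<lbrakk>u \<in> D; v \<in> D; w \<in> D\<rbrakk> \<Longrightarrow> \<langle>h (u + v), w\<rangle> = \<langle>h u, w\<rangle> + \<langle>h v, w\<rangle>"
    and "\<And>r u w. \<lbrakk>u \<in> D; w \<in> D\<rbrakk> \<Longrightarrow> \<langle>h (sD r u), w\<rangle> = r * \<langle>h u, w\<rangle>"
  shows "linear_on sD D sD D h"
  unfolding linear_on_def
proof (intro conjI ballI allI)
  fix u v r assume D: "u \<in> D" "v \<in> D"
  show "h u \<in> D" using D assms(1) by simp
  show "h (u + v) = h u + h v"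
    by (rule double_eqI) (simp_all add: D assms double_add_closed double_form_add_left)
  show "h (sD r u) = sD r (h u)"
    by (rule double_eqI) (simp_all add: D assms double_scale_closed double_form_scale_left)
qed

lemma fun_scale_apply: "fun_scale c f x = c * f x"
  by (simp add: fun_scale_def)

lemma form_mulD_add_right:
  assumes "u \<in> D" "v \<in> D" "v' \<in> D" "w \<in> D"
  shows "\<langle>mulD u (v + v'), w\<rangle> = \<langle>mulD u v, w\<rangle> + \<langle>mulD u v', w\<rangle>"
  using assms by (cases u; cases v; cases v'; cases w)
    (simp add: mem_double_carrier form_mulD dual_closed mul_add_right mul_add_left
      functional_add Delta.add_vector Delta.add_left Delta.add_right algebra_simps)

lemma form_mulD_scale_right:
  assumes "u \<in> D" "v \<in> D" "w \<in> D"
  shows "\<langle>mulD u (sD r v), w\<rangle> = r * \<langle>mulD u v, w\<rangle>"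
  using assms by (cases u; cases v; cases w)
    (simp add: mem_double_carrier double_scale_Pair form_mulD dual_closed mul_scale_right
      mul_scale_left functional_scale fun_scale_apply
      Delta.scale_vector Delta.scale_left' Delta.scale_right' algebra_simps)

lemma form_brD_add_right:
  assumes "u \<in> D" "v \<in> D" "v' \<in> D" "w \<in> D"
  shows "\<langle>brD u (v + v'), w\<rangle> = \<langle>brD u v, w\<rangle> + \<langle>brD u v', w\<rangle>"
  using assms by (cases u; cases v; cases v'; cases w)
    (simp add: mem_double_carrier form_brD dual_closed br_add_right br_add_left
      functional_add delta.add_vector delta.add_left delta.add_right algebra_simps)

lemma form_brD_scale_right:
  assumes "u \<in> D" "v \<in> D" "w \<in> D"
  shows "\<langle>brD u (sD r v), w\<rangle> = r * \<langle>brD u v, w\<rangle>"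
  using assms by (cases u; cases v; cases w)
    (simp add: mem_double_carrier double_scale_Pair form_brD dual_closed br_scale_right
      br_scale_left functional_scale fun_scale_apply
      delta.scale_vector delta.scale_left' delta.scale_right' algebra_simps)

lemma mulD_bilinear: "bilinear_on sD D sD D mulD"
proof -
  have "linear_on sD D sD D (mulD u)" if "u \<in> D" for u
    by (rule linear_on_doubleI) (simp_all add: that mulD_closed form_mulD_add_right form_mulD_scale_right)
  then show ?thesis
    by (simp add: bilinear_on_def mulD_commute[of _ u for u])
qed

lemma brD_bilinear: "bilinear_on sD D sD D brD"
proof -
  have right: "linear_on sD D sD D (brD u)" if "u \<in> D" for u
    by (rule linear_on_doubleI) (simp_all add: that brD_closed form_brD_add_right form_brD_scale_right)
  moreover have "linear_on sD D sD D (\<lambda>v. brD v u)" if u: "u \<in> D" for u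
  proof (rule linear_on_doubleI)
    fix v v' w r assume D: "v \<in> D" "v' \<in> D" "w \<in> D"
    have skew: "\<langle>brD v u, w\<rangle> = - \<langle>brD u v, w\<rangle>" if "v \<in> D" for v
      unfolding brD_skew[OF that u] using double_form_diff_left[OF D(3), of 0 "brD u v"]
      by (simp add: double_form_zero_left D)
    show "\<langle>brD (v + v') u, w\<rangle> = \<langle>brD v u, w\<rangle> + \<langle>brD v' u, w\<rangle>"
      by (simp add: skew D u double_add_closed form_brD_add_right form_brD_scale_right)
    show "\<langle>brD (sD r v) u, w\<rangle> = r * \<langle>brD v u, w\<rangle>"
      by (simp add: skew D u double_scale_closed form_brD_add_right form_brD_scale_right)
  qed (simp add: brD_closed u)
  ultimately show ?thesis by (simp add: bilinear_on_def)
qed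

text \<open>This moves the derivation to the third argument, where the conditions relating \<open>P\<close> and \<open>Q\<close> apply.\<close>
lemma form_PD: "\<langle>PD u, (z, c)\<rangle> = \<langle>u, (Q z, c \<circ> P)\<rangle>"
  by (cases u) (simp add: double_form_Pair dual_map_def)

lemma PD_mulD:
  assumes "u \<in> D" "v \<in> D"
  shows "PD (mulD u v) = mulD (PD u) v + mulD u (PD v)"
proof (rule double_eqI)
  fix w assume w: "w \<in> D"
  obtain x a y b z c where eq: "u = (x, a)" "v = (y, b)" "w = (z, c)"
    by (cases u; cases v; cases w)
  then have dual: "a \<in> dual" "b \<in> dual" "c \<in> dual"
    using assms w by (simp_all add: mem_double_carrier)
  have Px: "c (P (mul x y)) = c (mul (P x) y) + c (mul x (P y))"
    using dual by (simp add: P_mult functional_add)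
  have Qz: "f (mul x (Q z)) = f (mul (P x) z) + f (Q (mul x z))" if "f \<in> dual" for f x
    using dually_represents_mul[OF that, of x z] by (simp add: algebra_simps)
  have \<Delta>P: "\<Delta> x f (c \<circ> P) = \<Delta> (P x) f c + \<Delta> x (f \<circ> Q) c" if "f \<in> dual" for f x
    using Delta_P[of c f x] that dual by (simp add: Delta_commute[of _ c] Delta_commute[of _ "c \<circ> P"])
  show "\<langle>PD (mulD u v), w\<rangle> = \<langle>mulD (PD u) v + mulD u (PD v), w\<rangle>"
    using w unfolding double_form_add_left[OF w] unfolding eq
    by (simp add: form_PD form_mulD dual_map_def dual dual_closed Px Qz \<Delta>P Delta_Q algebra_simps)
qed (use assms in \<open>simp_all add: double_closed double_add_closed\<close>)

lemma PD_brD: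
  assumes "u \<in> D" "v \<in> D"
  shows "PD (brD u v) = brD (PD u) v + brD u (PD v)"
proof (rule double_eqI)
  fix w assume w: "w \<in> D"
  obtain x a y b z c where eq: "u = (x, a)" "v = (y, b)" "w = (z, c)"
    by (cases u; cases v; cases w)
  then have dual: "a \<in> dual" "b \<in> dual" "c \<in> dual"
    using assms w by (simp_all add: mem_double_carrier)
  have Px: "c (P (br x y)) = c (br (P x) y) + c (br x (P y))"
    using dual by (simp add: P_br functional_add)
  have Qz: "f (br x (Q z)) = f (br (P x) z) + f (Q (br x z))" if "f \<in> dual" for f x
    using dually_represents_br[OF that, of x z] by (simp add: algebra_simps)
  have \<delta>P: "\<delta> x f (c \<circ> P) = \<delta> (P x) f c + \<delta> x (f \<circ> Q) c" if "f \<in> dual" for f x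
    using delta_P[of c f x] that dual
    by (simp add: delta_skew[of _ c] delta_skew[of _ "c \<circ> P"] algebra_simps)
  show "\<langle>PD (brD u v), w\<rangle> = \<langle>brD (PD u) v + brD u (PD v), w\<rangle>"
    using w unfolding double_form_add_left[OF w] unfolding eq
    by (simp add: form_PD form_brD dual_map_def dual dual_closed Px Qz \<delta>P delta_Q algebra_simps)
qed (use assms in \<open>simp_all add: double_closed double_add_closed\<close>)

text \<open>In characteristic two a skew-symmetric cobracket need not define an alternating bracket.\<close>
lemma delta_op_self:
  assumes "(2 :: 'k) \<noteq> 0"
  shows "dual_op \<delta> f f = 0"
proof
  fix x
  have "2 * \<delta> x f f = 0"
    using delta_skew[of x f f] by (simp only: mult_2 eq_neg_iff_add_eq_0)
  then show "dual_op \<delta> f f x = 0 x"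
    using assms by (simp add: dual_op_apply)
qed

theorem double_relative_poisson_algebra:
  assumes two: "(2 :: 'k) \<noteq> 0"
  shows "relative_poisson_algebra sD D mulD brD PD"
proof -
  interpret dbl: fd_space sD D by (rule double_fd_space)
  have PD_linear: "linear_on sD D sD D PD"
  proof (rule linear_on_doubleI)
    fix u v w r assume D: "u \<in> D" "v \<in> D" "w \<in> D"
    obtain z c where w: "w = (z, c)" by (cases w)
    with D have "(Q z, c \<circ> P) \<in> D" by (simp add: mem_double_carrier dual_closed)
    then show "\<langle>PD (u + v), w\<rangle> = \<langle>PD u, w\<rangle> + \<langle>PD v, w\<rangle>" "\<langle>PD (sD r u), w\<rangle> = r * \<langle>PD u, w\<rangle>"
      unfolding w form_PD by (simp_all add: double_form_add_left double_form_scale_left)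
  qed (rule PD_closed)
  show ?thesis
  proof unfold_locales
    fix u v w assume D: "u \<in> D" "v \<in> D" "w \<in> D"
    note closed = D double_closed double_add_closed
    show "mulD u v = mulD v u" by (rule mulD_commute)
    show "PD (mulD u v) = mulD (PD u) v + mulD u (PD v)" by (rule PD_mulD) fact+
    show "PD (brD u v) = brD (PD u) v + brD u (PD v)" by (rule PD_brD) fact+
    show "mulD (mulD u v) w = mulD u (mulD v w)"
    proof (rule double_eqI)
      fix s assume s: "s \<in> D"
      have "\<langle>mulD (mulD u v) w, s\<rangle> = \<langle>mulD u v, mulD w s\<rangle>"
        by (simp add: form_mulD_invariant closed s)
      also have "\<dots> = \<langle>mulD v w, mulD u s\<rangle>"
        by (rule form_mulD_exchange) fact+
      also have "\<dots> = \<langle>mulD u (mulD v w), s\<rangle>"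
        by (simp add: mulD_commute[of u "mulD v w"] form_mulD_invariant closed s)
      finally show "\<langle>mulD (mulD u v) w, s\<rangle> = \<langle>mulD u (mulD v w), s\<rangle>" .
    qed (simp_all add: closed)
    show "brD u u = 0"
      using br_self[of "fst u"] delta_op_self[OF two, of "snd u"]
      by (cases u) (simp add: double_br_def zero_prod_def)
    show "brD u (brD v w) + brD v (brD w u) + brD w (brD u v) = 0"
    proof (rule double_form_nondegenerate)
      fix s assume s: "s \<in> D"
      have "\<langle>brD u (brD v w), s\<rangle> = \<langle>brD v w, brD s u\<rangle>" if "u \<in> D" "v \<in> D" "w \<in> D" for u v w
        using form_brD_invariant[of u "brD v w" s] form_brD_invariant[of "brD v w" s u] that s
        by (simp add: brD_closed double_form_commute[of u])
      then show "\<langle>brD u (brD v w) + brD v (brD w u) + brD w (brD u v), s\<rangle> = 0"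
        using form_brD_cyclic[of u v w s] D s by (simp add: double_form_add_left)
    qed (simp add: closed)
    show "brD w (mulD u v) = mulD (brD w u) v + mulD u (brD w v) + mulD (mulD u v) (PD w)"
    proof (rule double_eqI)
      fix s assume s: "s \<in> D"
      have br: "\<langle>brD w (mulD u v), s\<rangle> = - \<langle>mulD u v, brD w s\<rangle>"
        using double_form_diff_left[OF s, of 0 "brD (mulD u v) w"]
          form_brD_invariant[of "mulD u v" w s]
        by (simp add: brD_skew[of w "mulD u v"] closed s double_form_zero_left)
      have mul: "\<langle>mulD (brD w u) v, s\<rangle> = \<langle>mulD v s, brD w u\<rangle>"
          "\<langle>mulD u (brD w v), s\<rangle> = \<langle>mulD s u, brD w v\<rangle>"
        by (simp_all add: mulD_commute[of u] form_mulD_invariant closed s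
            double_form_commute[of "brD w u"] double_form_commute[of "brD w v"])
      have P: "\<langle>mulD (mulD u v) (PD w), s\<rangle> = \<langle>mulD u (PD w), mulD v s\<rangle>"
        using form_mulD_exchange[of v u "PD w" s] D s
        by (simp add: form_mulD_invariant closed mulD_commute[of u v])
      show "\<langle>brD w (mulD u v), s\<rangle> =
          \<langle>mulD (brD w u) v + mulD u (brD w v) + mulD (mulD u v) (PD w), s\<rangle>"
        unfolding double_form_add_left[OF s] br mul P
        by (rule minus_unique) (use form_relative_leibniz[OF D s] in \<open>simp add: add_ac\<close>)
    qed (simp_all add: closed)
  qed (fact mulD_bilinear brD_bilinear PD_linear)+
qed

section \<open>The unit of the double\<close>

text \<open>For a unit \<open>(f, \<phi>)\<close>, the component of \<open>(f, \<phi>) \<cdot> y = y\<close> in \<open>A\<^sup>*\<close> is \<open>\<phi> (y \<cdot> -) = 0\<close>, so \<open>\<phi> = 0\<close>; then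
  \<open>f \<cdot> y = y\<close>, so \<open>f = e\<close>. And \<open>(e, 0)\<close> fixes \<open>b \<in> A\<^sup>*\<close> exactly when the action of \<open>b\<close> on \<open>e\<close>, that is
  \<open>\<Delta> e b -\<close>, vanishes.\<close>
lemma unit_of_double_iff:
  assumes unit: "\<And>x. mul e x = x"
  shows "(u \<in> D \<and> (\<forall>w\<in>D. mulD u w = w)) \<longleftrightarrow> u = (e, 0) \<and> \<Delta> e = 0"
proof
  assume "u = (e, 0) \<and> \<Delta> e = 0"
  then have u: "u = (e, 0)" and \<Delta>e: "\<Delta> e = 0" by auto
  have "mulD u w = w" if w: "w \<in> D" for w
  proof (rule double_eqI)
    fix s assume s: "s \<in> D"
    obtain y b z c where eq: "w = (y, b)" "s = (z, c)" by (cases w; cases s)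
    then have dual: "b \<in> dual" "c \<in> dual"
      using w s by (simp_all add: mem_double_carrier)
    show "\<langle>mulD u w, s\<rangle> = \<langle>w, s\<rangle>"
      unfolding u eq by (simp add: form_mulD dual dual_closed unit \<Delta>e Delta.zero_left double_form_Pair)
  qed (simp_all add: w mulD_closed u mem_double_carrier dual_closed)
  then show "u \<in> D \<and> (\<forall>w\<in>D. mulD u w = w)"
    by (simp add: u mem_double_carrier dual_closed)
next
  assume "u \<in> D \<and> (\<forall>w\<in>D. mulD u w = w)"
  then have unitD: "\<And>w. w \<in> D \<Longrightarrow> mulD u w = w" and uD: "u \<in> D" by auto
  obtain f \<phi> where u: "u = (f, \<phi>)" by (cases u)
  with uD have \<phi>: "\<phi> \<in> dual" by (simp add: mem_double_carrier)
  have pair: "c (mul f y) + \<Delta> y \<phi> c + \<Delta> f b c + \<Delta> z \<phi> b + b (mul f z) + \<phi> (mul y z) = c y + b z"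
    if "b \<in> dual" "c \<in> dual" for y b z c
    using form_mulD[OF \<phi> that, of f y z] unitD[of "(y, b)"] that
    by (simp add: u mem_double_carrier double_form_Pair)
  have "\<phi> z = 0" for z
    using pair[of 0 0 e z] by (simp add: dual_closed unit Delta.zero_right \<phi>)
  then have \<phi>0: "\<phi> = 0" by (simp add: fun_eq_iff)
  have f: "f = e"
  proof (rule dual_separates)
    fix c assume "c \<in> dual"
    then show "c f = c e"
      using pair[of 0 c e 0]
      by (simp add: dual_closed \<phi>0 Delta.zero_left Delta.zero_right mul_commute[of f e] unit)
  qed
  have "\<Delta> e b c = 0" for b c
  proof (cases "b \<in> dual \<and> c \<in> dual")
    case True
    then show ?thesis
      using pair[of b c 0 0] by (simp add: \<phi>0 f unit functional_zero Delta.zero_left)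
  next
    case False
    then show ?thesis using tensor2_eq_0[OF Delta.D_in_tensor2, of b c e] by blast
  qed
  then show "u = (e, 0) \<and> \<Delta> e = 0"
    by (simp add: u f \<phi>0 fun_eq_iff)
qed

lemma double_frobenius_jacobi_algebra:
  assumes "jacobi_algebra sD D mulD brD u"
  shows "frobenius_jacobi_algebra sD D mulD brD u double_form"
proof -
  interpret dbl: jacobi_algebra sD D mulD brD u by fact
  show ?thesis
    by unfold_locales
      (use double_form_bilinear double_form_commute double_form_nondegenerate form_mulD_invariant
        form_brD_invariant in blast)+
qed

end

lemma coboundary_unit:
  assumes "coboundary s mul br \<Delta> \<delta>" and unit: "\<And>x. mul e x = x"
  shows "\<Delta> e = 0"
proof -
  have "mul e = id" using unit by (simp add: fun_eq_iff)
  then show ?thesis using assms(1) by (force simp: coboundary_def)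
qed

section \<open>Jacobi algebras\<close>

theorem corollary5p2:
  fixes scale :: "'k::{alg_closed_field, field_char_0} \<Rightarrow> 'a::ab_group_add \<Rightarrow> 'a"
    and mul br :: "'a \<Rightarrow> 'a \<Rightarrow> 'a" and e :: 'a
    and \<Delta> \<delta> :: "'a \<Rightarrow> ('a \<Rightarrow> 'k) \<Rightarrow> ('a \<Rightarrow> 'k) \<Rightarrow> 'k"
  assumes "jacobi_algebra scale UNIV mul br e"
    and "relative_poisson_bialgebra scale mul br \<Delta> \<delta> (br e) (- br e)"
  shows
    "let D = double_carrier scale;
         sD = double_scale scale;
         mulD = double_mul scale mul \<Delta>;
         brD = double_br scale br \<delta>;
         PD = map_prod (br e) (- dual_map (br e))
     in
       relative_poisson_algebra sD D mulD brD PD \<and>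
       (unital_relative_poisson_algebra sD D mulD brD PD \<longleftrightarrow> \<Delta> e = 0) \<and>
       ((\<exists>u. jacobi_algebra sD D mulD brD u) \<longleftrightarrow> \<Delta> e = 0) \<and>
       (\<Delta> e = 0 \<longrightarrow>
         (\<exists>u. frobenius_jacobi_algebra sD D mulD brD u double_form \<and> (\<forall>w\<in>D. PD w = brD u w))) \<and>
       (coboundary scale mul br \<Delta> \<delta> \<longrightarrow> \<Delta> e = 0)"
proof -
  interpret A: jacobi_algebra scale UNIV mul br e by fact
  interpret B: relative_poisson_bialgebra scale mul br \<Delta> \<delta> "br e" "- br e" by fact
  let ?PD = "map_prod (br e) (- dual_map (br e))"
  have e: "mul e x = x" for x by (rule A.unit) simp
  have "?PD w = map_prod (br e) (dual_map (- br e)) w" if "w \<in> B.D" for w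
    using that
    by (cases w) (auto simp: mem_double_carrier dual_map_def fun_eq_iff A.functional_uminus)
  then have rpa: "relative_poisson_algebra B.sD B.D B.mulD B.brD ?PD"
    using relative_poisson_algebra_cong[OF B.double_relative_poisson_algebra] by simp
  interpret dbl: relative_poisson_algebra B.sD B.D B.mulD B.brD ?PD by (rule rpa)
  have unit_iff: "(u \<in> B.D \<and> (\<forall>w\<in>B.D. B.mulD u w = w)) \<longleftrightarrow> u = (e, 0) \<and> \<Delta> e = 0" for u
    by (rule B.unit_of_double_iff) (rule e)
  have unital: "unital_relative_poisson_algebra B.sD B.D B.mulD B.brD ?PD \<longleftrightarrow> \<Delta> e = 0"
    using rpa unit_iff
    by (auto simp: unital_relative_poisson_algebra_def unital_relative_poisson_algebra_axioms_def Bex_def)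
  have jacobi: "jacobi_algebra B.sD B.D B.mulD B.brD u \<longleftrightarrow> u = (e, 0) \<and> \<Delta> e = 0" for u
    using dbl.jacobi_algebra_of_unit[of u] jacobi_algebra.unit[of B.sD B.D B.mulD B.brD u]
      jacobi_algebra.unit_closed[of B.sD B.D B.mulD B.brD u] unit_iff[of u]
    by blast
  have frobenius: "frobenius_jacobi_algebra B.sD B.D B.mulD B.brD (e, 0) double_form \<and>
      (\<forall>w\<in>B.D. ?PD w = B.brD (e, 0) w)" if "\<Delta> e = 0"
    using that unit_iff[of "(e, 0)"] jacobi[of "(e, 0)"] B.double_frobenius_jacobi_algebra
      dbl.derivation_eq_ad_unit[of "(e, 0)"] by blast
  show ?thesis
    unfolding Let_def
    using rpa unital jacobi frobenius coboundary_unit[of scale mul br \<Delta> \<delta> e] e by blast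
qed

end
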